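(* Let $\delta\in(0,1)$, $0<\rho_*\le\rho^*<\infty$, and let $c_{\rm LSE}>0$ (depending only on $\rho_*,\rho^*$) and $C_{\rm LSE}>0$ be suitable constants. There exist constants $c_0>0$ (depending only on $\rho_*$) and $C,C'>0$ (depending only on $\rho_*,\delta$) such that the following holds. Suppose the LSE condition holds with constants $\rho_*,\rho^*,c_{\rm LSE},C_{\rm LSE}$ and radius $r$, that $\mathrm{w}\in\mathcal T$, and that $\mathrm{w}(u)\ge 1/2$ for $u=18\rho_*^{-1}\delta^{-1}\lambda$. Suppose $$4\big(\|\nabla\mathcal L(\boldsymbol\beta^* )\|_\infty+\max\{\varepsilon_t,\varepsilon_c\}\big)\le\lambda\le c_0\,\frac{r}{\sqrt s}.$$ Let $\widetilde{\boldsymbol\beta}^{(1)},\widetilde{\boldsymbol\beta}^{(2)},\dots$ be approximate solutions as described in the context ($\varepsilon_c$-optimal for $\ell=1$, $\varepsilon_t$-optimal for $\ell\ge2$). Then for every $\ell\ge 2$, $$\|\widetilde{\boldsymbol\beta}^{(\ell)}-\boldsymbol\beta^*\|_2\le C\Big(\|\nabla\mathcal L(\boldsymbol\beta^* )_S\|_2+\varepsilon_t\sqrt s+\lambda\|\mathrm{w}(|\boldsymbol\beta^*_S|-u)\|_2\Big)+\delta\,\|\widetilde{\boldsymbol\beta}^{(\ell-1)}-\boldsymbol\beta^*\|_2 ,$$ and consequently $$\|\widetilde{\boldsymbol\beta}^{(\ell)}-\boldsymbol\beta^*\|_2\le C'\Big(\|\nabla\mathcal L(\boldsymbol\beta^*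 )_S\|_2+\varepsilon_t\sqrt s+\lambda\|\mathrm{w}(|\boldsymbol\beta^*_S|-u)\|_2\Big)+2C'\delta^{\ell-1}\lambda\sqrt s .$$
   Context: Setting. $\boldsymbol\beta^*\in\mathbb R^d$ is the true parameter, $S=\mathrm{supp}(\boldsymbol\beta^* )$, $s=|S|\geq 1$. For a vector $\mathbf v\in\mathbb R^d$ and an index set $I$, $\mathbf v_I$ keeps the coordinates in $I$ and sets the others to $0$; $\|\mathbf v\|_0$ is the number of nonzero coordinates; $\odot$ is the entrywise product; $|\mathbf v|$ is taken entrywise; $B_2(r,\boldsymbol\beta^* )=\{\boldsymbol\beta:\|\boldsymbol\beta-\boldsymbol\beta^*\|_2\le r\}$. The loss $\mathcal L:\mathbb R^d\to\mathbb R$ is convex, with continuous gradient $\nabla\mathcal L$ that is differentiable on $B_2(r,\boldsymbol\beta^* )$ (with Hessian $\nabla^2\mathcal L$). $\mathrm{w}(|\boldsymbol\beta^*_S|-u)$ denotes the vector $(\mathrm{w}(|\beta^*_j|-u))_{j\in S}$. Localized sparse eigenvalues: $\rho_+(m,r)$ and $\rho_-(m,r)$ are the supremum and infimum, respectively, of $\mathbf u_J^{T}\nabla^2\mathcal L(\boldsymbol\beta)\mathbf u_J$ over all $\mathbf u,J,\boldsymbol\beta$ with $\|\mathbf u_J\|_2=1$, $|J|\le m$, $\|\boldsymbol\beta-\boldsymbol\beta^*\|_2\le r$. LSE condition with constants $\rho_*,\rho^*,c_{\rm LSE},C_{\rm LSE}$ and radius $r$: there is an integer $\widetilde s\ge c_{\rm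 LSE}s$ with $0<\rho_*\le\rho_-(2s+2\widetilde s,r)<\rho_+(2s+2\widetilde s,r)\le\rho^*<\infty$ and $\rho_+(\widetilde s,r)/\rho_-(2s+2\widetilde s,r)\le 1+C_{\rm LSE}\,\widetilde s/s$. Tightening class $\mathcal T$: functions $\mathrm{w}:\mathbb R\to\mathbb R$ with $\mathrm{w}(t_1)\le\mathrm{w}(t_2)$ for $t_1\ge t_2\ge0$, $0\le\mathrm{w}(t)\le1$ for $t\ge0$, and $\mathrm{w}(t)=1$ for $t\le0$. Approximate solutions: $\lambda>0$, $\varepsilon_c,\varepsilon_t\geq 0$, $\widetilde{\boldsymbol\beta}^{(0)}=\mathbf 0$, and $\boldsymbol\lambda^{(\ell-1)}=(\lambda\mathrm{w}(|\widetilde\beta^{(\ell-1)}_j|))_{j=1}^d$ (so $\boldsymbol\lambda^{(0)}=\lambda\mathbf 1$). For a weight vector $\boldsymbol\lambda$, $\omega_{\boldsymbol\lambda}(\boldsymbol\beta)=\min_{\boldsymbol\xi\in\partial\|\boldsymbol\beta\|_1}\|\nabla\mathcal L(\boldsymbol\beta)+\boldsymbol\lambda\odot\boldsymbol\xi\|_\infty$. $\widetilde{\boldsymbol\beta}^{(\ell)}$ is called an $\varepsilon$-optimal solution of the $\ell$-th problem $\min_{\boldsymbol\beta}\{\mathcal L(\boldsymbol\beta)+\|\boldsymbol\lambda^{(\ell-1)}\odot\boldsymbol\beta\|_1\}$ if $\omega_{\boldsymbol\lambda^{(\ell-1)}}(\widetilde{\boldsymbol\beta}^{(\ell)})\le\varepsilon$.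 $\widetilde{\boldsymbol\beta}^{(1)}$ is any $\varepsilon_c$-optimal solution of the first problem, and for $\ell\ge2$, $\widetilde{\boldsymbol\beta}^{(\ell)}$ is any $\varepsilon_t$-optimal solution of the $\ell$-th problem. *)

theory Defs
  imports "HOL-Analysis.Analysis"
begin

text \<open>
  The constants in the theorem must not depend on the dimension, so the dimension has to be
  a natural number \<open>d\<close> bound inside the statement rather than a type.  Vectors of
  \<open>\<real>\<^sup>d\<close> are functions on \<open>nat\<close> with coordinates \<open>0, \<dots>, d - 1\<close> that vanish from \<open>d\<close> on;
  a \<open>d \<times> d\<close> matrix is a function \<open>nat \<Rightarrow> nat \<Rightarrow> real\<close> of which only the entries with both
  indices below \<open>d\<close> are ever used.
\<close>

type_synonym vec = "nat \<Rightarrow> real"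

definition Rvec :: "nat \<Rightarrow> vec set" where
  "Rvec d = {v. \<forall>j\<ge>d. v j = 0}"

definition dotp :: "nat \<Rightarrow> vec \<Rightarrow> vec \<Rightarrow> real" where
  "dotp d u v = (\<Sum>j<d. u j * v j)"

definition matvec :: "nat \<Rightarrow> (nat \<Rightarrow> nat \<Rightarrow> real) \<Rightarrow> vec \<Rightarrow> vec" where
  "matvec d A v = (\<lambda>i. if i < d then \<Sum>j<d. A i j * v j else 0)"

definition norm1 :: "nat \<Rightarrow> vec \<Rightarrow> real" where
  "norm1 d v = (\<Sum>j<d. \<bar>v j\<bar>)"

definition norm2 :: "nat \<Rightarrow> vec \<Rightarrow> real" where
  "norm2 d v = L2_set v {..<d}"

text \<open>Only meaningful for \<open>d > 0\<close>, which is forced by a nonempty support.\<close>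

definition norm_inf :: "nat \<Rightarrow> vec \<Rightarrow> real" where
  "norm_inf d v = Max ((\<lambda>j. \<bar>v j\<bar>) ` {..<d})"

definition supp :: "nat \<Rightarrow> vec \<Rightarrow> nat set" where
  "supp d v = {j. j < d \<and> v j \<noteq> 0}"

definition proj :: "nat set \<Rightarrow> vec \<Rightarrow> vec" where
  "proj I v = (\<lambda>j. if j \<in> I then v j else 0)"

definition vadd :: "vec \<Rightarrow> vec \<Rightarrow> vec" where
  "vadd u v = (\<lambda>j. u j + v j)"

definition vsub :: "vec \<Rightarrow> vec \<Rightarrow> vec" where
  "vsub u v = (\<lambda>j. u j - v j)"

definition vscale :: "real \<Rightarrow> vec \<Rightarrow> vec" where
  "vscale c v = (\<lambda>j. c * v j)"

definition vcball :: "nat \<Rightarrow> vec \<Rightarrow> real \<Rightarrow> vec set" where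
  "vcball d x r = {y \<in> Rvec d. norm2 d (vsub y x) \<le> r}"

definition vconvex :: "nat \<Rightarrow> (vec \<Rightarrow> real) \<Rightarrow> bool" where
  "vconvex d f \<longleftrightarrow> (\<forall>x\<in>Rvec d. \<forall>y\<in>Rvec d. \<forall>t\<in>{0..1}.
     f (vadd (vscale (1 - t) x) (vscale t y)) \<le> (1 - t) * f x + t * f y)"

text \<open>Frechet differentiability on \<open>\<real>\<^sup>d\<close>: \<open>p\<close> is the gradient of \<open>f\<close> at \<open>x\<close>, respectively
  \<open>A\<close> is the Jacobian matrix of \<open>F\<close> at \<open>x\<close>.\<close>

definition has_gradient :: "nat \<Rightarrow> (vec \<Rightarrow> real) \<Rightarrow> vec \<Rightarrow> vec \<Rightarrow> bool" where
  "has_gradient d f p x \<longleftrightarrow> (\<forall>e>0. \<exists>\<eta>>0. \<forall>h\<in>Rvec d. norm2 d h < \<eta> \<longrightarrow>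
     \<bar>f (vadd x h) - f x - dotp d p h\<bar> \<le> e * norm2 d h)"

definition has_jacobian ::
    "nat \<Rightarrow> (vec \<Rightarrow> vec) \<Rightarrow> (nat \<Rightarrow> nat \<Rightarrow> real) \<Rightarrow> vec \<Rightarrow> bool" where
  "has_jacobian d F A x \<longleftrightarrow> (\<forall>e>0. \<exists>\<eta>>0. \<forall>h\<in>Rvec d. norm2 d h < \<eta> \<longrightarrow>
     norm2 d (vsub (vsub (F (vadd x h)) (F x)) (matvec d A h)) \<le> e * norm2 d h)"

text \<open>\<open>G\<close> and \<open>H\<close> are the gradient (on all of \<open>\<real>\<^sup>d\<close>) and the Hessian (on the ball) of the
  loss \<open>L\<close>.  The \<open>continuous_on\<close> refers to the product topology on \<open>nat \<Rightarrow> real\<close>, which on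
  \<open>Rvec d\<close> is the Euclidean topology.\<close>

definition smooth_convex_loss ::
    "nat \<Rightarrow> vec \<Rightarrow> real \<Rightarrow> (vec \<Rightarrow> real) \<Rightarrow> (vec \<Rightarrow> vec) \<Rightarrow> (vec \<Rightarrow> nat \<Rightarrow> nat \<Rightarrow> real) \<Rightarrow> bool"
  where
  "smooth_convex_loss d bstar r L G H \<longleftrightarrow>
     vconvex d L \<and>
     (\<forall>x\<in>Rvec d. G x \<in> Rvec d \<and> has_gradient d L (G x) x) \<and>
     continuous_on (Rvec d) G \<and>
     (\<forall>x\<in>vcball d bstar r. has_jacobian d G (H x) x)"

text \<open>Extended reals, so that the supremum of an unbounded set is \<open>\<infinity>\<close>.\<close>

definition sparse_forms ::
    "nat \<Rightarrow> vec \<Rightarrow> (vec \<Rightarrow> nat \<Rightarrow> nat \<Rightarrow> real) \<Rightarrow> nat \<Rightarrow> real \<Rightarrow> ereal set" where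
  "sparse_forms d bstar H m r =
     {ereal (dotp d (proj J u) (matvec d (H b) (proj J u))) | u J b.
        u \<in> Rvec d \<and> J \<subseteq> {..<d} \<and> card J \<le> m \<and> norm2 d (proj J u) = 1 \<and> b \<in> vcball d bstar r}"

definition rho_plus ::
    "nat \<Rightarrow> vec \<Rightarrow> (vec \<Rightarrow> nat \<Rightarrow> nat \<Rightarrow> real) \<Rightarrow> nat \<Rightarrow> real \<Rightarrow> ereal" where
  "rho_plus d bstar H m r = Sup (sparse_forms d bstar H m r)"

definition rho_minus ::
    "nat \<Rightarrow> vec \<Rightarrow> (vec \<Rightarrow> nat \<Rightarrow> nat \<Rightarrow> real) \<Rightarrow> nat \<Rightarrow> real \<Rightarrow> ereal" where
  "rho_minus d bstar H m r = Inf (sparse_forms d bstar H m r)"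

definition LSE ::
    "nat \<Rightarrow> vec \<Rightarrow> (vec \<Rightarrow> nat \<Rightarrow> nat \<Rightarrow> real) \<Rightarrow> real \<Rightarrow> real \<Rightarrow> real \<Rightarrow> real \<Rightarrow> real \<Rightarrow> bool" where
  "LSE d bstar H rlo rhi cLSE CLSE r \<longleftrightarrow>
     (let s = card (supp d bstar) in
      \<exists>st::nat. real st \<ge> cLSE * real s \<and>
        0 < rlo \<and>
        ereal rlo \<le> rho_minus d bstar H (2 * s + 2 * st) r \<and>
        rho_minus d bstar H (2 * s + 2 * st) r < rho_plus d bstar H (2 * s + 2 * st) r \<and>
        rho_plus d bstar H (2 * s + 2 * st) r \<le> ereal rhi \<and>
        rho_plus d bstar H st r / rho_minus d bstar H (2 * s + 2 * st) r
          \<le> ereal (1 + CLSE * (real st / real s)))"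

definition tightening :: "(real \<Rightarrow> real) set" where
  "tightening = {w. (\<forall>t1 t2. t1 \<ge> t2 \<and> t2 \<ge> 0 \<longrightarrow> w t1 \<le> w t2) \<and>
     (\<forall>t\<ge>0. 0 \<le> w t \<and> w t \<le> 1) \<and> (\<forall>t\<le>0. w t = 1)}"

definition subdifferential :: "nat \<Rightarrow> (vec \<Rightarrow> real) \<Rightarrow> vec \<Rightarrow> vec set" where
  "subdifferential d f x =
     {\<xi> \<in> Rvec d. \<forall>z\<in>Rvec d. f z \<ge> f x + dotp d \<xi> (vsub z x)}"

text \<open>The infimum is a minimum: the subdifferential of the 1-norm is nonempty and compact.\<close>

definition omega :: "nat \<Rightarrow> (vec \<Rightarrow> vec) \<Rightarrow> vec \<Rightarrow> vec \<Rightarrow> real" where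
  "omega d G lam b =
     (INF \<xi>\<in>subdifferential d (norm1 d) b. norm_inf d (\<lambda>j. G b j + lam j * \<xi> j))"

definition eps_optimal :: "nat \<Rightarrow> (vec \<Rightarrow> vec) \<Rightarrow> vec \<Rightarrow> real \<Rightarrow> vec \<Rightarrow> bool" where
  "eps_optimal d G lam eps b \<longleftrightarrow> b \<in> Rvec d \<and> omega d G lam b \<le> eps"

text \<open>\<open>B l\<close> is the approximate solution of the \<open>l\<close>-th problem.\<close>

definition approx_solutions ::
    "nat \<Rightarrow> (vec \<Rightarrow> vec) \<Rightarrow> (real \<Rightarrow> real) \<Rightarrow> real \<Rightarrow> real \<Rightarrow> real \<Rightarrow> (nat \<Rightarrow> vec) \<Rightarrow> bool" where
  "approx_solutions d G w lam epsc epst B \<longleftrightarrow>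
     B 0 = (\<lambda>j. 0) \<and>
     (\<forall>l\<ge>1. eps_optimal d G (\<lambda>j. lam * w \<bar>B (l - 1) j\<bar>) (if l = 1 then epsc else epst) (B l))"

end

theory Submission
  imports Defs
begin

text \<open>
  Two facts carry the proof: the loss is strongly convex along every direction that a weighted
  \<open>\<ell>\<^sub>1\<close> problem can produce, and the weights of one step are as good as the previous estimate.

  \<^emph>\<open>Curvature.\<close>  Let \<open>v\<close> satisfy \<open>\<parallel>v\<^bsub>E\<^sup>c\<^esub>\<parallel>\<^sub>1 \<le> 5\<parallel>v\<^sub>E\<parallel>\<^sub>1\<close> with \<open>|E| \<le> 2s\<close>.  Add to \<open>E\<close> the \<open>k\<close> largest
  entries of \<open>v\<close> outside \<open>E\<close>, giving \<open>J\<close>.  The rest of \<open>v\<close> splits into \<open>k\<close>-sparse blocks of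
  decreasing size, so every seminorm bounded by \<open>M\<parallel>\<cdot>\<parallel>\<^sub>2\<close> on \<open>k\<close>-sparse vectors is at most
  \<open>M\<parallel>v\<^bsub>E\<^sup>c\<^esub>\<parallel>\<^sub>1/\<surd>k\<close> on it (\<open>tail_estimate\<close>).  The square root of the Hessian form is such a
  seminorm because the loss is convex.  If \<open>k/s\<close> is a large multiple of \<open>rhi/rlo\<close>, the tail is
  negligible against \<open>v\<^sub>J\<close>, where the lower sparse eigenvalue applies, and the form is at least
  \<open>(rlo/2)\<parallel>v\<parallel>\<^sub>2\<^sup>2\<close> (\<open>quad_lower_bound_on_cone\<close>).  The mean value theorem transfers this to
  gradient differences (\<open>cone_strong_convexity\<close>).

  \<^emph>\<open>One weighted problem.\<close>  Pairing the approximate stationarity condition with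
  \<open>\<Delta> = b - bstar\<close> (\<open>basic_inequality\<close>) puts \<open>\<Delta>\<close> into the cone, provided that the weights are at
  least \<open>lam/2\<close> outside \<open>E\<close>, and bounds the gradient difference along \<open>\<Delta>\<close> by \<open>K\<parallel>\<Delta>\<parallel>\<^sub>2\<close>, where
  \<open>K\<close> collects the gradient and the weights on \<open>S\<close>, the tolerance, and
  \<open>(lam/4)\<surd>|E - S|\<close>.  Curvature then gives \<open>(rlo/2)\<parallel>\<Delta>\<parallel>\<^sub>2 \<le> K\<close>.  Curvature is known only in the ball
  of radius \<open>r\<close>; as the gradient is monotone along rays, a solution outside the ball would give a
  point on its boundary with the same estimate, which the upper bound on \<open>lam\<close> excludes
  (\<open>weighted_solution_error\<close>).

  \<^emph>\<open>Contraction.\<close>  In step \<open>l\<close> take \<open>E\<close> to be \<open>S\<close> together with the coordinates of weight below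
  \<open>lam/2\<close>.  A coordinate of \<open>E - S\<close> has previous error above \<open>u\<close>, and a coordinate of \<open>S\<close> whose
  weight exceeds \<open>lam\<cdot>w(|bstar\<^sub>j| - u)\<close> has previous error at least \<open>u\<close>.  Both contribute at most
  a multiple of \<open>lam/u = rlo\<cdot>\<delta>/18\<close> times the previous error to \<open>K\<close>, which makes the total factor
  at most \<open>\<delta>\<close>.  The crude bound \<open>3lam\<surd>s/rlo\<close> on every error keeps \<open>|E - S| \<le> s\<close> by induction.
  Summing the geometric series gives the second estimate.
\<close>

section \<open>Vectors as functions\<close>

lemma vadd_in_Rvec: "x \<in> Rvec d \<Longrightarrow> y \<in> Rvec d \<Longrightarrow> vadd x y \<in> Rvec d"
  by (simp add: Rvec_def vadd_def)

lemma vsub_in_Rvec: "x \<in> Rvec d \<Longrightarrow> y \<in> Rvec d \<Longrightarrow> vsub x y \<in> Rvec d"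
  by (simp add: Rvec_def vsub_def)

lemma vscale_in_Rvec: "x \<in> Rvec d \<Longrightarrow> vscale c x \<in> Rvec d"
  by (simp add: Rvec_def vscale_def)

lemma norm2_nonneg: "norm2 d v \<ge> 0"
  by (simp add: norm2_def)

lemma norm2_vscale: "norm2 d (vscale c v) = \<bar>c\<bar> * norm2 d v"
  using L2_set_right_distrib[of "\<bar>c\<bar>" v "{..<d}"]
  by (simp add: norm2_def vscale_def L2_set_def power_mult_distrib)

lemma norm2_proj:
  assumes "J \<subseteq> {..<d}"
  shows "norm2 d (proj J v) = L2_set v J"
proof -
  have "(\<Sum>j<d. (proj J v j)\<^sup>2) = (\<Sum>j\<in>J. (v j)\<^sup>2)"
    by (rule sum.mono_neutral_cong_right) (use assms in \<open>auto simp: proj_def\<close>)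
  then show ?thesis by (simp add: norm2_def L2_set_def)
qed

lemma L2_set_le_norm2:
  assumes "J \<subseteq> {..<d}"
  shows "L2_set v J \<le> norm2 d v"
  unfolding norm2_def L2_set_def
  by (intro real_sqrt_le_mono sum_mono2) (use assms in auto)

lemma dotp_le_norms: "\<bar>dotp d x y\<bar> \<le> norm2 d x * norm2 d y"
proof -
  have "\<bar>dotp d x y\<bar> \<le> (\<Sum>j<d. \<bar>x j\<bar> * \<bar>y j\<bar>)"
    unfolding dotp_def by (rule order_trans[OF sum_abs]) (simp add: abs_mult)
  also have "\<dots> \<le> norm2 d x * norm2 d y"
    unfolding norm2_def by (rule L2_set_mult_ineq)
  finally show ?thesis .
qed

lemma dotp_vscale_right: "dotp d x (vscale c y) = c * dotp d x y"
  by (simp add: dotp_def vscale_def sum_distrib_left mult.left_commute)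

lemma dotp_vsub_left: "dotp d (vsub x y) z = dotp d x z - dotp d y z"
  by (simp add: dotp_def vsub_def left_diff_distrib sum_subtractf)

lemma abs_coord_le_norm_inf: "j < d \<Longrightarrow> \<bar>v j\<bar> \<le> norm_inf d v"
  unfolding norm_inf_def by (rule Max_ge) auto

lemma sum_abs_le_sqrt_card_L2:
  fixes v :: "'a \<Rightarrow> real"
  shows "(\<Sum>j\<in>A. \<bar>v j\<bar>) \<le> sqrt (card A) * L2_set v A"
  using L2_set_mult_ineq[of "\<lambda>_. 1::real" v A] by (simp add: L2_set_def)

lemma L2_set_const_bound:
  fixes v :: "'a \<Rightarrow> real"
  assumes "\<And>j. j \<in> A \<Longrightarrow> \<bar>v j\<bar> \<le> M" "0 \<le> M"
  shows "L2_set v A \<le> sqrt (card A) * M"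
proof -
  have "(\<Sum>j\<in>A. (v j)\<^sup>2) \<le> (\<Sum>j\<in>A. M\<^sup>2)"
    using assms by (intro sum_mono) (metis abs_le_square_iff abs_of_nonneg)
  then have "L2_set v A \<le> sqrt (card A * M\<^sup>2)"
    unfolding L2_set_def by (simp add: real_sqrt_le_mono)
  then show ?thesis using assms(2) by (simp add: real_sqrt_mult)
qed

lemma L2_set_Un_le:
  assumes "finite A" "finite B" "A \<inter> B = {}"
  shows "L2_set v (A \<union> B) \<le> L2_set v A + L2_set v B"
  unfolding L2_set_def
  by (simp add: sum.union_disjoint[OF assms] sqrt_add_le_add_sqrt sum_nonneg)

section \<open>The tail of a vector after its largest entries\<close>

lemma top_subset_exists:
  fixes f :: "'a \<Rightarrow> real"
  assumes "finite T" "k \<le> card T"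
  shows "\<exists>I\<subseteq>T. card I = k \<and> (\<forall>i\<in>I. \<forall>j\<in>T - I. f j \<le> f i)"
  using assms(2)
proof (induction k)
  case 0
  then show ?case by (intro exI[of _ "{}"]) auto
next
  case (Suc k)
  then obtain I where I: "I \<subseteq> T" "card I = k" "\<forall>i\<in>I. \<forall>j\<in>T - I. f j \<le> f i" by auto
  have fin: "finite I" using I(1) assms(1) finite_subset by blast
  have "T - I \<noteq> {}"
    using Suc.prems I fin card_mono[OF fin, of T] by auto
  then have "Max (f ` (T - I)) \<in> f ` (T - I)" using assms(1) by (intro Max_in) auto
  then obtain m where m: "m \<in> T - I" "f m = Max (f ` (T - I))" by auto
  then have m_max: "\<forall>j\<in>T - I. f j \<le> f m" using assms(1) by simp
  show ?case
    by (rule exI[of _ "insert m I"]) (use I m(1) m_max fin in auto)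
qed

text \<open>
  The block argument as an induction on the size of \<open>T\<close>.  Peel off a block \<open>K\<close> of the \<open>k\<close> largest
  entries.  Its smallest entry \<open>m\<close> bounds all that remains, and \<open>k m \<le> \<parallel>v\<^sub>K\<parallel>\<^sub>1\<close>: the price
  \<open>\<surd>k\<cdot>m\<close> for the next block is paid by the \<open>\<ell>\<^sub>1\<close> mass of this one.  The set function \<open>P\<close> stands
  for \<open>K \<mapsto> p (v\<^sub>K)\<close> with a seminorm \<open>p\<close>, so that one lemma serves the Euclidean norm and the
  square root of a quadratic form.
\<close>

lemma bounded_sum_estimate:
  fixes P :: "'a set \<Rightarrow> real" and v :: "'a \<Rightarrow> real"
  assumes "0 < k" "0 \<le> C" "finite T"
    and sub: "\<And>K K'. K \<subseteq> T \<Longrightarrow> K' \<subseteq> T \<Longrightarrow> K \<inter> K' = {} \<Longrightarrow> P (K \<union> K') \<le> P K + P K'"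
    and sparse: "\<And>K. K \<subseteq> T \<Longrightarrow> card K \<le> k \<Longrightarrow> P K \<le> C * L2_set v K"
    and "0 \<le> M" "\<And>j. j \<in> T \<Longrightarrow> \<bar>v j\<bar> \<le> M"
  shows "P T \<le> C * (sqrt k * M + (\<Sum>j\<in>T. \<bar>v j\<bar>) / sqrt k)"
  using assms(3-)
proof (induction "card T" arbitrary: T M rule: less_induct)
  case less
  note finT = less.prems(1) and sub = less.prems(2) and sparse = less.prems(3)
    and M0 = less.prems(4) and M = less.prems(5)
  have sparse_M: "P K \<le> C * (sqrt k * M)" if "K \<subseteq> T" "card K \<le> k" for K
  proof -
    have "L2_set v K \<le> sqrt (card K) * M"
      by (rule L2_set_const_bound) (use M that M0 in auto)
    also have "\<dots> \<le> sqrt k * M" using that M0 by (intro mult_right_mono) auto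
    finally show ?thesis using sparse[OF that] \<open>0 \<le> C\<close> by (meson mult_left_mono order_trans)
  qed
  show ?case
  proof (cases "card T \<le> k")
    case True
    have "C * (sqrt k * M) \<le> C * (sqrt k * M + (\<Sum>j\<in>T. \<bar>v j\<bar>) / sqrt k)"
      using \<open>0 \<le> C\<close> by (intro mult_left_mono) (auto simp: sum_nonneg)
    then show ?thesis using sparse_M[OF subset_refl True] by linarith
  next
    case False
    then obtain K where K: "K \<subseteq> T" "card K = k" "\<forall>i\<in>K. \<forall>j\<in>T - K. \<bar>v j\<bar> \<le> \<bar>v i\<bar>"
      using top_subset_exists[OF finT, of k "\<lambda>j. \<bar>v j\<bar>"] by auto
    have finK: "finite K" using K(1) finT finite_subset by blast
    have "K \<noteq> {}" using K(2) \<open>0 < k\<close> by auto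
    define m where "m = Min ((\<lambda>j. \<bar>v j\<bar>) ` K)"
    have m: "m \<le> \<bar>v i\<bar>" if "i \<in> K" for i
      unfolding m_def using finK that by (intro Min_le) auto
    have m_in: "m \<in> (\<lambda>j. \<bar>v j\<bar>) ` K"
      unfolding m_def using finK \<open>K \<noteq> {}\<close> by (intro Min_in) auto
    have m0: "0 \<le> m" and mtail: "\<And>j. j \<in> T - K \<Longrightarrow> \<bar>v j\<bar> \<le> m" using m_in K(3) by auto
    have "k * m \<le> (\<Sum>j\<in>K. \<bar>v j\<bar>)"
      using sum_bounded_below[of K m "\<lambda>j. \<bar>v j\<bar>"] m K(2) by simp
    then have "k * m / sqrt k \<le> (\<Sum>j\<in>K. \<bar>v j\<bar>) / sqrt k"
      by (intro divide_right_mono) auto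
    moreover have "k * m / sqrt k = (real k / sqrt k) * m" by simp
    then have "k * m / sqrt k = sqrt k * m" by (simp only: real_div_sqrt of_nat_0_le_iff)
    ultimately have block: "sqrt k * m \<le> (\<Sum>j\<in>K. \<bar>v j\<bar>) / sqrt k" by simp
    have "P (T - K) \<le> C * (sqrt k * m + (\<Sum>j\<in>T - K. \<bar>v j\<bar>) / sqrt k)"
    proof (rule less.hyps)
      show "card (T - K) < card T"
        using K(1) \<open>K \<noteq> {}\<close> finT by (intro psubset_card_mono) auto
      show "P (A \<union> A') \<le> P A + P A'" if "A \<subseteq> T - K" "A' \<subseteq> T - K" "A \<inter> A' = {}" for A A'
        using that by (intro sub) auto
      show "P A \<le> C * L2_set v A" if "A \<subseteq> T - K" "card A \<le> k" for A
        using that by (intro sparse) auto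
    qed (use finT m0 mtail in auto)
    also have "\<dots> \<le> C * ((\<Sum>j\<in>K. \<bar>v j\<bar>) / sqrt k + (\<Sum>j\<in>T - K. \<bar>v j\<bar>) / sqrt k)"
      using block \<open>0 \<le> C\<close> by (intro mult_left_mono) auto
    also have "\<dots> = C * ((\<Sum>j\<in>T. \<bar>v j\<bar>) / sqrt k)"
      using sum.subset_diff[OF K(1) finT, of "\<lambda>j. \<bar>v j\<bar>"]
      by (simp add: add_divide_distrib[symmetric] add.commute)
    finally have tail: "P (T - K) \<le> C * ((\<Sum>j\<in>T. \<bar>v j\<bar>) / sqrt k)" .
    have "P T = P (K \<union> (T - K))" using K(1) by (simp add: Un_absorb1)
    also have "\<dots> \<le> P K + P (T - K)" by (rule sub) (use K(1) in auto)
    also have "\<dots> \<le> C * (sqrt k * M) + C * ((\<Sum>j\<in>T. \<bar>v j\<bar>) / sqrt k)"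
      using sparse_M[of K] K tail by auto
    finally show ?thesis by (simp add: distrib_left)
  qed
qed

text \<open>
  The \<open>k\<close> largest entries have mean at least the maximum \<open>M\<close> of the others, so the bound
  \<open>\<surd>k\<cdot>M\<close> for the first tail block is again covered by \<open>\<ell>\<^sub>1\<close> mass.  The set \<open>I\<close> must be the same for
  all \<open>P\<close>, since two seminorms are used with it at once.
\<close>

lemma tail_estimate:
  fixes v :: "'a \<Rightarrow> real"
  assumes "0 < k" "finite T"
  obtains I where "I \<subseteq> T" "card I \<le> k"
    "\<And>P C. 0 \<le> C \<Longrightarrow>
       (\<And>K K'. K \<subseteq> T \<Longrightarrow> K' \<subseteq> T \<Longrightarrow> K \<inter> K' = {} \<Longrightarrow> P (K \<union> K') \<le> P K + P K') \<Longrightarrow>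
       (\<And>K. K \<subseteq> T \<Longrightarrow> card K \<le> k \<Longrightarrow> P K \<le> C * L2_set v K) \<Longrightarrow>
       P (T - I) \<le> C * ((\<Sum>j\<in>T. \<bar>v j\<bar>) / sqrt k)"
proof (cases "card T \<le> k")
  case True
  show ?thesis
  proof (rule that[of T])
    fix P :: "'a set \<Rightarrow> real" and C :: real
    assume C: "0 \<le> C" and sp: "\<And>K. K \<subseteq> T \<Longrightarrow> card K \<le> k \<Longrightarrow> P K \<le> C * L2_set v K"
    have "0 \<le> C * ((\<Sum>j\<in>T. \<bar>v j\<bar>) / sqrt k)"
      using C by (simp add: sum_nonneg)
    then show "P (T - T) \<le> C * ((\<Sum>j\<in>T. \<bar>v j\<bar>) / sqrt k)"
      using sp[of "{}"] by simp
  qed (use True in auto)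
next
  case False
  then obtain I where I: "I \<subseteq> T" "card I = k" "\<forall>i\<in>I. \<forall>j\<in>T - I. \<bar>v j\<bar> \<le> \<bar>v i\<bar>"
    using top_subset_exists[OF assms(2), of k "\<lambda>j. \<bar>v j\<bar>"] by auto
  define M where "M = (\<Sum>i\<in>I. \<bar>v i\<bar>) / k"
  have M: "\<bar>v j\<bar> \<le> M" if "j \<in> T - I" for j
    using sum_bounded_below[of I "\<bar>v j\<bar>" "\<lambda>i. \<bar>v i\<bar>"] I that \<open>0 < k\<close>
    by (simp add: M_def field_simps)
  have kM: "sqrt k * M = (\<Sum>i\<in>I. \<bar>v i\<bar>) / sqrt k"
    unfolding M_def using \<open>0 < k\<close> by (simp add: field_simps)
  show ?thesis
  proof (rule that[of I])
    fix P :: "'a set \<Rightarrow> real" and C :: real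
    assume C: "0 \<le> C"
      and sub: "\<And>K K'. K \<subseteq> T \<Longrightarrow> K' \<subseteq> T \<Longrightarrow> K \<inter> K' = {} \<Longrightarrow> P (K \<union> K') \<le> P K + P K'"
      and sp: "\<And>K. K \<subseteq> T \<Longrightarrow> card K \<le> k \<Longrightarrow> P K \<le> C * L2_set v K"
    have "P (T - I) \<le> C * (sqrt k * M + (\<Sum>j\<in>T - I. \<bar>v j\<bar>) / sqrt k)"
    proof (rule bounded_sum_estimate)
      show "0 \<le> M" by (simp add: M_def sum_nonneg)
      show "P (K \<union> K') \<le> P K + P K'" if "K \<subseteq> T - I" "K' \<subseteq> T - I" "K \<inter> K' = {}" for K K'
        using that by (intro sub) auto
      show "P K \<le> C * L2_set v K" if "K \<subseteq> T - I" "card K \<le> k" for K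
        using that by (intro sp) auto
    qed (use assms C M in auto)
    also have "\<dots> = C * ((\<Sum>j\<in>T. \<bar>v j\<bar>) / sqrt k)"
      unfolding kM using sum.subset_diff[OF I(1) assms(2), of "\<lambda>j. \<bar>v j\<bar>"]
      by (simp add: add_divide_distrib[symmetric] add.commute)
    finally show "P (T - I) \<le> C * ((\<Sum>j\<in>T. \<bar>v j\<bar>) / sqrt k)" .
  qed (use I in auto)
qed

section \<open>Quadratic forms on the cone\<close>

definition quad :: "nat \<Rightarrow> (nat \<Rightarrow> nat \<Rightarrow> real) \<Rightarrow> vec \<Rightarrow> real" where
  "quad d A x = dotp d x (matvec d A x)"

lemma quad_expand: "quad d A x = (\<Sum>i<d. \<Sum>j<d. x i * A i j * x j)"
  by (simp add: quad_def dotp_def matvec_def sum_distrib_left mult.assoc)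

lemma quad_vscale: "quad d A (vscale c x) = c\<^sup>2 * quad d A x"
  by (simp add: quad_expand vscale_def sum_distrib_left power2_eq_square mult_ac)

lemma quad_line:
  "quad d A (vadd x (vscale t y)) =
     quad d A x + t * (dotp d x (matvec d A y) + dotp d y (matvec d A x)) + t\<^sup>2 * quad d A y"
  by (simp add: quad_expand dotp_def matvec_def vadd_def vscale_def sum_distrib_left sum.distrib
      algebra_simps power2_eq_square)

text \<open>The discriminant condition, tested at the zero of the derivative in \<open>t\<close>.\<close>

lemma nonneg_quadratic_cross_term:
  fixes a b c :: real
  assumes "\<And>t. 0 \<le> a\<^sup>2 + t * b + t\<^sup>2 * c\<^sup>2" "0 \<le> a" "0 \<le> c"
  shows "b \<le> 2 * a * c"
proof (cases "c = 0")
  case True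
  have "b = 0"
  proof (rule ccontr)
    assume "b \<noteq> 0"
    \<comment> \<open>At this \<open>t\<close> the linear function \<open>a\<^sup>2 + t b\<close> equals \<open>-1\<close>.\<close>
    then show False using assms(1)[of "- (a\<^sup>2 + 1) / b"] True by simp
  qed
  then show ?thesis using True by simp
next
  case False
  then have c: "0 < c" using assms(3) by simp
  show ?thesis
  proof (rule ccontr)
    assume "\<not> b \<le> 2 * a * c"
    then have b: "2 * a * c < b" by simp
    have "0 \<le> a\<^sup>2 + (- b / (2 * c\<^sup>2)) * b + (- b / (2 * c\<^sup>2))\<^sup>2 * c\<^sup>2" by (rule assms(1))
    also have "\<dots> = (4 * a\<^sup>2 * c\<^sup>2 - b\<^sup>2) / (4 * c\<^sup>2)"
      using c by (simp add: field_simps power2_eq_square)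
    finally have "b\<^sup>2 \<le> (2 * a * c)\<^sup>2"
      using c by (simp add: zero_le_divide_iff power_mult_distrib)
    moreover have "(2 * a * c)\<^sup>2 < b\<^sup>2"
      using b assms(2) c by (intro power_strict_mono) auto
    ultimately show False by simp
  qed
qed

text \<open>
  Cauchy--Schwarz for the cross term \<open>x\<^sup>TAy + y\<^sup>TAx\<close>, twice the bilinear form of the symmetric part
  of \<open>A\<close>.
\<close>

lemma sqrt_quad_subadditive:
  assumes psd: "\<And>y. y \<in> Rvec d \<Longrightarrow> 0 \<le> quad d A y"
    and x: "x \<in> Rvec d" and y: "y \<in> Rvec d"
  shows "sqrt (quad d A (vadd x y)) \<le> sqrt (quad d A x) + sqrt (quad d A y)"
proof -
  define b where "b = dotp d x (matvec d A y) + dotp d y (matvec d A x)"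
  have "b \<le> 2 * sqrt (quad d A x) * sqrt (quad d A y)"
  proof (rule nonneg_quadratic_cross_term)
    fix t
    show "0 \<le> (sqrt (quad d A x))\<^sup>2 + t * b + t\<^sup>2 * (sqrt (quad d A y))\<^sup>2"
      using psd[OF vadd_in_Rvec[OF x vscale_in_Rvec[OF y, of t]]] psd[OF x] psd[OF y]
      by (simp add: quad_line b_def)
  qed (use psd x y in auto)
  moreover have "quad d A (vadd x y) = quad d A x + b + quad d A y"
    using quad_line[of d A x 1 y] by (simp add: b_def vscale_def)
  ultimately have "quad d A (vadd x y) \<le> (sqrt (quad d A x) + sqrt (quad d A y))\<^sup>2"
    using psd x y by (simp add: power2_sum)
  then show ?thesis
    by (rule real_le_lsqrt[rotated]) (use psd x y in auto)
qed

lemma proj_in_Rvec: "K \<subseteq> {..<d} \<Longrightarrow> proj K v \<in> Rvec d"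
  by (force simp: proj_def Rvec_def)

lemma proj_Un: "K \<inter> K' = {} \<Longrightarrow> proj (K \<union> K') v = vadd (proj K v) (proj K' v)"
  by (auto simp: proj_def vadd_def fun_eq_iff)

lemma proj_all: "v \<in> Rvec d \<Longrightarrow> proj {..<d} v = v"
  by (auto simp: proj_def Rvec_def)

text \<open>
  With \<open>a = \<surd>(rlo/rhi)/10\<close>, the lower bound on \<open>k\<close> says exactly \<open>5\<surd>(2s) \<le> a\<surd>k\<close>.  By the cone
  condition the tail therefore has norm at most \<open>a\<parallel>v\<^sub>J\<parallel>\<^sub>2 \<le> \<parallel>v\<^sub>J\<parallel>\<^sub>2/10\<close> and form root at most
  \<open>\<surd>rhi\<cdot>a\<parallel>v\<^sub>J\<parallel>\<^sub>2 = \<surd>rlo\<parallel>v\<^sub>J\<parallel>\<^sub>2/10\<close>.  So \<open>v\<close> keeps \<open>9/10\<close> of \<open>\<surd>rlo\<parallel>v\<^sub>J\<parallel>\<^sub>2\<close> while its norm is at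
  most \<open>11/10\<close> of \<open>\<parallel>v\<^sub>J\<parallel>\<^sub>2\<close>, and \<open>(9/11)\<^sup>2 \<ge> 1/2\<close>.
\<close>

lemma quad_lower_bound_on_cone:
  assumes psd: "\<And>y. y \<in> Rvec d \<Longrightarrow> 0 \<le> quad d A y"
    and upper: "\<And>K. K \<subseteq> {..<d} \<Longrightarrow> card K \<le> k \<Longrightarrow> quad d A (proj K v) \<le> rhi * (L2_set v K)\<^sup>2"
    and lower: "\<And>K. K \<subseteq> {..<d} \<Longrightarrow> card K \<le> 2 * s + k \<Longrightarrow>
                  rlo * (L2_set v K)\<^sup>2 \<le> quad d A (proj K v)"
    and "0 < rlo" "rlo \<le> rhi" "0 < s" and k: "5000 * (rhi / rlo) * s \<le> k"
    and v: "v \<in> Rvec d" and E: "E \<subseteq> {..<d}" "card E \<le> 2 * s"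
    and cone: "(\<Sum>j\<in>{..<d} - E. \<bar>v j\<bar>) \<le> 5 * (\<Sum>j\<in>E. \<bar>v j\<bar>)"
  shows "rlo / 2 * (norm2 d v)\<^sup>2 \<le> quad d A v"
proof -
  define T where "T = {..<d} - E"
  define a where "a = sqrt (rlo / rhi) / 10"
  define n where "n = (\<lambda>K. L2_set v K)"
  define p where "p = (\<lambda>K. sqrt (quad d A (proj K v)))"
  have rhi0: "0 < rhi" using assms by linarith
  have k0: "0 < k"
  proof -
    have "0 < 5000 * (rhi / rlo) * s" using \<open>0 < rlo\<close> rhi0 \<open>0 < s\<close> by simp
    then show ?thesis using k by (simp add: order_less_le_trans)
  qed
  have finT: "finite T" by (simp add: T_def)
  obtain I where I: "I \<subseteq> T" "card I \<le> k"
    and tail: "\<And>P C. 0 \<le> C \<Longrightarrow>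
       (\<And>K K'. K \<subseteq> T \<Longrightarrow> K' \<subseteq> T \<Longrightarrow> K \<inter> K' = {} \<Longrightarrow> P (K \<union> K') \<le> P K + P K') \<Longrightarrow>
       (\<And>K. K \<subseteq> T \<Longrightarrow> card K \<le> k \<Longrightarrow> P K \<le> C * L2_set v K) \<Longrightarrow>
       P (T - I) \<le> C * ((\<Sum>j\<in>T. \<bar>v j\<bar>) / sqrt k)"
    using tail_estimate[OF k0 finT, of v] by metis
  define J where "J = E \<union> I"
  have J: "J \<subseteq> {..<d}" using E I by (auto simp: J_def T_def)
  have cardJ: "card J \<le> 2 * s + k"
    using card_Un_le[of E I] E(2) I(2) by (simp add: J_def)
  have TI: "T - I = {..<d} - J" by (auto simp: T_def J_def)
  have n0: "0 \<le> n K" for K by (simp add: n_def)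
  have p_sub: "p (K \<union> K') \<le> p K + p K'" if "K \<subseteq> {..<d}" "K' \<subseteq> {..<d}" "K \<inter> K' = {}" for K K'
    using that by (simp add: p_def proj_Un sqrt_quad_subadditive[OF psd] proj_in_Rvec)
  have n_sub: "n (K \<union> K') \<le> n K + n K'" if "K \<subseteq> {..<d}" "K' \<subseteq> {..<d}" "K \<inter> K' = {}" for K K'
    unfolding n_def using that by (intro L2_set_Un_le) (auto intro: finite_subset)
  have p_tail: "p (T - I) \<le> sqrt rhi * ((\<Sum>j\<in>T. \<bar>v j\<bar>) / sqrt k)"
  proof (rule tail)
    fix K assume K: "K \<subseteq> T" "card K \<le> k"
    have "p K \<le> sqrt (rhi * (L2_set v K)\<^sup>2)"
      unfolding p_def by (rule real_sqrt_le_mono, rule upper) (use K in \<open>auto simp: T_def\<close>)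
    then show "p K \<le> sqrt rhi * L2_set v K" by (simp add: real_sqrt_mult)
  next
    fix K K' assume "K \<subseteq> T" "K' \<subseteq> T" "K \<inter> K' = {}"
    then show "p (K \<union> K') \<le> p K + p K'" by (intro p_sub) (auto simp: T_def)
  qed (use rhi0 in simp)
  have n_tail: "n (T - I) \<le> 1 * ((\<Sum>j\<in>T. \<bar>v j\<bar>) / sqrt k)"
  proof (rule tail)
    fix K K' assume "K \<subseteq> T" "K' \<subseteq> T" "K \<inter> K' = {}"
    then show "n (K \<union> K') \<le> n K + n K'" by (intro n_sub) (auto simp: T_def)
  qed (auto simp: n_def)
  have "(\<Sum>j\<in>T. \<bar>v j\<bar>) / sqrt k \<le> a * n J"
  proof -
    have "sqrt (5000 * (rhi / rlo) * s) \<le> sqrt k" using k by simp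
    moreover have "a * sqrt (5000 * (rhi / rlo) * s) = 5 * sqrt (2 * s)"
    proof -
      have "a * sqrt (5000 * (rhi / rlo) * s) =
            (sqrt (rlo / rhi) * sqrt (5000 * (rhi / rlo) * s)) / 10"
        by (simp add: a_def)
      also have "\<dots> = sqrt ((rlo / rhi) * (5000 * (rhi / rlo) * s)) / 10"
        by (simp only: real_sqrt_mult)
      also have "(rlo / rhi) * (5000 * (rhi / rlo) * s) = 50\<^sup>2 * (2 * real s)"
        using \<open>0 < rlo\<close> rhi0 by (simp add: field_simps)
      also have "sqrt (50\<^sup>2 * (2 * real s)) / 10 = (sqrt (50\<^sup>2) * sqrt (2 * real s)) / 10"
        by (simp only: real_sqrt_mult)
      also have "\<dots> = 5 * sqrt (2 * s)" by simp
      finally show ?thesis .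
    qed
    ultimately have ak: "5 * sqrt (2 * s) \<le> a * sqrt k"
      using \<open>0 < rlo\<close> rhi0 by (metis a_def divide_nonneg_nonneg less_imp_le mult_left_mono
          real_sqrt_ge_zero zero_le_numeral)
    have EJ: "n E \<le> n J"
      unfolding n_def L2_set_def J_def
      by (intro real_sqrt_le_mono sum_mono2) (use E I finT in \<open>auto intro: finite_subset\<close>)
    have "(\<Sum>j\<in>T. \<bar>v j\<bar>) \<le> 5 * (sqrt (card E) * n E)"
      using cone sum_abs_le_sqrt_card_L2[of v E] by (simp add: T_def n_def)
    also have "\<dots> \<le> 5 * (sqrt (2 * s) * n J)"
      using E(2) EJ n0 by (intro mult_left_mono mult_mono) auto
    also have "\<dots> \<le> (a * sqrt k) * n J"
      using mult_right_mono[OF ak n0[of J]] by (simp add: mult.assoc)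
    finally show ?thesis using k0 by (simp add: field_simps)
  qed
  then have p_tail': "p (T - I) \<le> sqrt rhi * a * n J" and n_tail': "n (T - I) \<le> a * n J"
    using p_tail n_tail rhi0 mult_left_mono[of _ "a * n J" "sqrt rhi"]
    by (fastforce simp: mult.assoc)+
  have aa: "sqrt rhi * a = sqrt rlo / 10" "a \<le> 1 / 10"
    using rhi0 assms(4,5) by (auto simp: a_def real_sqrt_divide)
  have n_tail'': "n (T - I) \<le> n J / 10"
    using n_tail' mult_right_mono[OF aa(2) n0[of J]] by simp
  have pJ: "sqrt rlo * n J \<le> p J"
    using real_sqrt_le_mono[OF lower[OF J cardJ]] n0[of J]
    by (simp add: p_def n_def real_sqrt_mult)
  have "p J \<le> p {..<d} + p (T - I)"
  proof -
    \<comment> \<open>The restriction to \<open>J\<close> is \<open>v\<close> plus the negative of the tail, which has the same form value.\<close>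
    have "proj J v = vadd v (vscale (-1) (proj (T - I) v))"
      using J v by (auto simp: TI proj_def vadd_def vscale_def Rvec_def fun_eq_iff)
    moreover have "quad d A (vscale (-1) (proj (T - I) v)) = quad d A (proj (T - I) v)"
      by (simp add: quad_vscale)
    ultimately show ?thesis
      using sqrt_quad_subadditive[OF psd v, of "vscale (-1) (proj (T - I) v)"] v
      by (simp add: p_def proj_all vscale_in_Rvec proj_in_Rvec TI)
  qed
  then have p_low: "9 / 10 * (sqrt rlo * n J) \<le> sqrt (quad d A v)"
    using pJ p_tail' aa v by (simp add: p_def proj_all)
  have "n {..<d} \<le> n J + n (T - I)"
    using n_sub[of J "T - I"] J by (simp add: TI Un_absorb1)
  then have n_up: "norm2 d v \<le> 11 / 10 * n J"
    using n_tail'' by (simp add: n_def norm2_def)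
  have "81 / 100 * (rlo * (n J)\<^sup>2) = (9 / 10 * (sqrt rlo * n J))\<^sup>2"
    using \<open>0 < rlo\<close> by (simp add: power_mult_distrib power_divide)
  also have "\<dots> \<le> (sqrt (quad d A v))\<^sup>2"
    by (intro power_mono p_low) (use \<open>0 < rlo\<close> n0[of J] in auto)
  also have "\<dots> = quad d A v" using psd v by simp
  finally have low: "81 / 100 * (rlo * (n J)\<^sup>2) \<le> quad d A v" .
  have "(norm2 d v)\<^sup>2 \<le> (11 / 10 * n J)\<^sup>2"
    by (intro power_mono n_up norm2_nonneg)
  then have "rlo * (norm2 d v)\<^sup>2 \<le> rlo * (121 / 100 * (n J)\<^sup>2)"
    using \<open>0 < rlo\<close> by (intro mult_left_mono) (auto simp: power_mult_distrib power_divide)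
  moreover have "0 \<le> rlo * (n J)\<^sup>2" using \<open>0 < rlo\<close> by simp
  ultimately show ?thesis using low by simp
qed

section \<open>Gradients and Hessians of a convex loss\<close>

lemma derivative_along_line:
  assumes jac: "has_jacobian d G A (vadd x (vscale t y))" and y: "y \<in> Rvec d"
  shows "((\<lambda>t. dotp d (G (vadd x (vscale t y))) y) has_real_derivative quad d A y) (at t)"
  unfolding has_field_derivative_def has_derivative_at_alt
proof (intro conjI allI impI)
  show "bounded_linear ((*) (quad d A y))" by (rule bounded_linear_mult_right)
next
  fix e :: real assume e: "0 < e"
  define N where "N = norm2 d y"
  have N: "0 \<le> N" by (simp add: N_def norm2_nonneg)
  have "0 < e / (N\<^sup>2 + 1)" using e by (simp add: add_nonneg_pos)
  then obtain \<eta> where \<eta>: "0 < \<eta>" and bd: "\<And>h. h \<in> Rvec d \<Longrightarrow> norm2 d h < \<eta> \<Longrightarrow>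
     norm2 d (vsub (vsub (G (vadd (vadd x (vscale t y)) h)) (G (vadd x (vscale t y)))) (matvec d A h))
       \<le> e / (N\<^sup>2 + 1) * norm2 d h"
    using jac unfolding has_jacobian_def by meson
  show "\<exists>\<delta>>0. \<forall>t'. norm (t' - t) < \<delta> \<longrightarrow>
      norm (dotp d (G (vadd x (vscale t' y))) y - dotp d (G (vadd x (vscale t y))) y
        - quad d A y * (t' - t)) \<le> e * norm (t' - t)"
  proof (intro exI[of _ "\<eta> / (N + 1)"] conjI allI impI)
    show "0 < \<eta> / (N + 1)" using \<eta> N by simp
  next
    fix t' assume t': "norm (t' - t) < \<eta> / (N + 1)"
    define h where "h = vscale (t' - t) y"
    have hR: "h \<in> Rvec d" using y by (simp add: h_def vscale_in_Rvec)
    have nh: "norm2 d h = \<bar>t' - t\<bar> * N" by (simp add: h_def N_def norm2_vscale)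
    have "\<bar>t' - t\<bar> * N \<le> \<bar>t' - t\<bar> * (N + 1)" by (simp add: mult_left_mono)
    also have "\<dots> < \<eta>" using t' N by (simp add: pos_less_divide_eq)
    finally have small: "norm2 d h < \<eta>" by (simp add: nh)
    have pt: "vadd (vadd x (vscale t y)) h = vadd x (vscale t' y)"
      by (simp add: h_def vadd_def vscale_def fun_eq_iff algebra_simps)
    define R where "R = vsub (vsub (G (vadd x (vscale t' y))) (G (vadd x (vscale t y)))) (matvec d A h)"
    have "norm2 d R \<le> e / (N\<^sup>2 + 1) * (\<bar>t' - t\<bar> * N)"
      using bd[OF hR small] unfolding pt R_def nh .
    then have "norm2 d R * N \<le> e / (N\<^sup>2 + 1) * (\<bar>t' - t\<bar> * N) * N"
      using N by (rule mult_right_mono)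
    also have "\<dots> = e * \<bar>t' - t\<bar> * (N\<^sup>2 / (N\<^sup>2 + 1))" by (simp add: power2_eq_square)
    also have "\<dots> \<le> e * \<bar>t' - t\<bar> * 1"
      using e by (intro mult_left_mono) (auto simp: divide_le_eq_1 add_nonneg_pos)
    finally have "\<bar>dotp d R y\<bar> \<le> e * \<bar>t' - t\<bar>"
      using dotp_le_norms[of d R y] by (simp add: N_def)
    moreover have "dotp d (matvec d A h) y = quad d A y * (t' - t)"
      by (simp add: h_def quad_def dotp_def matvec_def vscale_def sum_distrib_left
          sum_distrib_right mult_ac)
    ultimately show "norm (dotp d (G (vadd x (vscale t' y))) y - dotp d (G (vadd x (vscale t y))) y
        - quad d A y * (t' - t)) \<le> e * norm (t' - t)"
      by (simp add: R_def dotp_vsub_left)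
  qed
qed

text \<open>
  Convexity bounds the difference quotient over \<open>[0, t]\<close> by the one over \<open>[0, 1]\<close>; the gradient is
  the limit of the former as \<open>t\<close> tends to \<open>0\<close>.
\<close>

lemma convex_above_tangent:
  assumes conv: "vconvex d L" and grad: "has_gradient d L p x"
    and x: "x \<in> Rvec d" and h: "h \<in> Rvec d"
  shows "L x + dotp d p h \<le> L (vadd x h)"
proof -
  define N where "N = norm2 d h"
  have N: "0 \<le> N" by (simp add: N_def norm2_nonneg)
  have "dotp d p h \<le> L (vadd x h) - L x + e" if e: "0 < e" for e
  proof -
    have "0 < e / (N + 1)" using e N by simp
    then obtain \<eta> where \<eta>: "0 < \<eta>" and bd: "\<And>k. k \<in> Rvec d \<Longrightarrow> norm2 d k < \<eta> \<Longrightarrow>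
        \<bar>L (vadd x k) - L x - dotp d p k\<bar> \<le> e / (N + 1) * norm2 d k"
      using grad unfolding has_gradient_def by meson
    define t where "t = min 1 (\<eta> / (2 * (N + 1)))"
    have t: "0 < t" "t \<le> 1" using \<eta> N by (auto simp: t_def)
    have "t * N \<le> \<eta> / (2 * (N + 1)) * N" using N by (intro mult_right_mono) (auto simp: t_def)
    also have "\<dots> = \<eta> / 2 * (N / (N + 1))" using N by (simp add: field_simps)
    also have "\<dots> \<le> \<eta> / 2 * 1" using N \<eta> by (intro mult_left_mono) auto
    also have "\<dots> < \<eta>" using \<eta> by simp
    finally have small: "norm2 d (vscale t h) < \<eta>" using t by (simp add: norm2_vscale N_def)
    have "t * dotp d p h - e / (N + 1) * (t * N) \<le> L (vadd x (vscale t h)) - L x"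
      using bd[OF vscale_in_Rvec[OF h] small] t by (simp add: dotp_vscale_right norm2_vscale N_def)
    moreover have "e / (N + 1) * (t * N) \<le> t * e"
    proof -
      have "e / (N + 1) * (t * N) = t * e * (N / (N + 1))" using N by (simp add: field_simps)
      also have "\<dots> \<le> t * e * 1" using N t e by (intro mult_left_mono) auto
      finally show ?thesis by simp
    qed
    moreover have "L (vadd x (vscale t h)) \<le> (1 - t) * L x + t * L (vadd x h)"
    proof -
      have "vadd (vscale (1 - t) x) (vscale t (vadd x h)) = vadd x (vscale t h)"
        by (simp add: vadd_def vscale_def fun_eq_iff algebra_simps)
      then show ?thesis
        using conv x vadd_in_Rvec[OF x h] t unfolding vconvex_def
        by (metis atLeastAtMost_iff less_imp_le)
    qed
    ultimately have "t * dotp d p h \<le> t * (L (vadd x h) - L x + e)"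
      by (simp add: algebra_simps)
    then show ?thesis using t by simp
  qed
  then have "dotp d p h \<le> L (vadd x h) - L x" by (rule field_le_epsilon)
  then show ?thesis by simp
qed

text \<open>Add the tangent inequalities at \<open>x\<close> and at \<open>y\<close>.\<close>

lemma gradient_monotone:
  assumes loss: "smooth_convex_loss d bstar r L G H" and x: "x \<in> Rvec d" and y: "y \<in> Rvec d"
  shows "0 \<le> dotp d (vsub (G y) (G x)) (vsub y x)"
proof -
  have conv: "vconvex d L" and gx: "has_gradient d L (G x) x" and gy: "has_gradient d L (G y) y"
    using loss x y by (auto simp: smooth_convex_loss_def)
  have eqs: "vadd x (vsub y x) = y" "vadd y (vsub x y) = x"
    by (auto simp: vadd_def vsub_def)
  have "dotp d (G y) (vsub x y) = - dotp d (G y) (vsub y x)"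
    by (simp add: dotp_def vsub_def algebra_simps sum_subtractf)
  then show ?thesis
    using convex_above_tangent[OF conv gx x vsub_in_Rvec[OF y x]]
      convex_above_tangent[OF conv gy y vsub_in_Rvec[OF x y]]
    by (simp add: eqs dotp_vsub_left)
qed

lemma gradient_along_line_mono:
  assumes loss: "smooth_convex_loss d bstar r L G H" and x: "x \<in> Rvec d" and y: "y \<in> Rvec d"
  shows "mono (\<lambda>t. dotp d (G (vadd x (vscale t y))) y)"
proof (rule monoI)
  fix t t' :: real assume "t \<le> t'"
  show "dotp d (G (vadd x (vscale t y))) y \<le> dotp d (G (vadd x (vscale t' y))) y"
  proof (cases "t = t'")
    case False
    then have "0 < t' - t" using \<open>t \<le> t'\<close> by simp
    moreover have "vsub (vadd x (vscale t' y)) (vadd x (vscale t y)) = vscale (t' - t) y"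
      by (simp add: vsub_def vadd_def vscale_def fun_eq_iff algebra_simps)
    then have "0 \<le> (t' - t) *
        dotp d (vsub (G (vadd x (vscale t' y))) (G (vadd x (vscale t y)))) y"
      using gradient_monotone[OF loss, of "vadd x (vscale t y)" "vadd x (vscale t' y)"] x y
      by (simp add: dotp_vscale_right vadd_in_Rvec vscale_in_Rvec)
    ultimately show ?thesis by (simp add: zero_le_mult_iff dotp_vsub_left)
  qed simp
qed

text \<open>The form in direction \<open>y\<close> is the derivative of a monotone function of one variable.\<close>

lemma hessian_psd:
  assumes loss: "smooth_convex_loss d bstar r L G H" and b: "b \<in> vcball d bstar r"
    and y: "y \<in> Rvec d"
  shows "0 \<le> quad d (H b) y"
proof -
  have bR: "b \<in> Rvec d" and jac: "has_jacobian d G (H b) b"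
    using loss b by (auto simp: smooth_convex_loss_def vcball_def)
  have "vadd b (vscale 0 y) = b" by (simp add: vadd_def vscale_def)
  then have "((\<lambda>t. dotp d (G (vadd b (vscale t y))) y) has_real_derivative quad d (H b) y) (at 0)"
    using derivative_along_line[of d G "H b" b 0 y] jac y by simp
  moreover have "mono_on UNIV (\<lambda>t. dotp d (G (vadd b (vscale t y))) y)"
    using gradient_along_line_mono[OF loss bR y] .
  ultimately show ?thesis
    by (intro mono_on_imp_deriv_nonneg[of UNIV _ _ 0]) auto
qed

lemma gradient_growth:
  assumes jac: "\<And>t. 0 \<le> t \<Longrightarrow> t \<le> 1 \<Longrightarrow>
      has_jacobian d G (H (vadd x (vscale t y))) (vadd x (vscale t y))"
    and low: "\<And>t. 0 \<le> t \<Longrightarrow> t \<le> 1 \<Longrightarrow> m \<le> quad d (H (vadd x (vscale t y))) y"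
    and y: "y \<in> Rvec d"
  shows "m \<le> dotp d (vsub (G (vadd x y)) (G x)) y"
proof -
  define \<phi> where "\<phi> = (\<lambda>t. dotp d (G (vadd x (vscale t y))) y)"
  have "\<exists>z>0. z < 1 \<and> \<phi> 1 - \<phi> 0 = (1 - 0) * quad d (H (vadd x (vscale z y))) y"
    by (rule MVT2) (auto simp: \<phi>_def intro!: derivative_along_line jac y)
  then obtain z where "0 < z" "z < 1" "\<phi> 1 - \<phi> 0 = quad d (H (vadd x (vscale z y))) y"
    by auto
  moreover have "\<phi> 1 - \<phi> 0 = dotp d (vsub (G (vadd x y)) (G x)) y"
    by (simp add: \<phi>_def dotp_vsub_left vscale_def vadd_def)
  ultimately show ?thesis using low[of z] by simp
qed

section \<open>Strong convexity on the cone\<close>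

text \<open>
  The two sparse eigenvalue bounds freed from the normalisation to unit vectors; \<open>k\<close> is the integer
  whose existence the LSE condition asserts.
\<close>

lemma LSE_sparse_bounds:
  assumes LSE: "LSE d bstar H rlo rhi c C r"
  obtains k :: nat where "c * card (supp d bstar) \<le> k"
    and "\<And>b v K. b \<in> vcball d bstar r \<Longrightarrow> K \<subseteq> {..<d} \<Longrightarrow>
      card K \<le> 2 * card (supp d bstar) + 2 * k \<Longrightarrow>
      rlo * (L2_set v K)\<^sup>2 \<le> quad d (H b) (proj K v) \<and>
      quad d (H b) (proj K v) \<le> rhi * (L2_set v K)\<^sup>2"
proof -
  define s where "s = card (supp d bstar)"
  obtain k :: nat where k: "c * real s \<le> k"
    and lo: "ereal rlo \<le> rho_minus d bstar H (2 * s + 2 * k) r"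
    and hi: "rho_plus d bstar H (2 * s + 2 * k) r \<le> ereal rhi"
    using LSE unfolding LSE_def Let_def s_def by auto
  have bounds: "rlo * (L2_set v K)\<^sup>2 \<le> quad d (H b) (proj K v) \<and>
      quad d (H b) (proj K v) \<le> rhi * (L2_set v K)\<^sup>2"
    if b: "b \<in> vcball d bstar r" and K: "K \<subseteq> {..<d}" and card: "card K \<le> 2 * s + 2 * k" for b v K
  proof (cases "L2_set v K = 0")
    case True
    have "finite K" using K finite_subset by blast
    then have "proj K v = (\<lambda>_. 0)" using True by (auto simp: L2_set_eq_0_iff proj_def)
    then show ?thesis using True by (simp add: quad_expand)
  next
    case False
    define n where "n = L2_set v K"
    have n: "0 < n" using False by (simp add: n_def order_less_le)
    define z where "z = vscale (1 / n) (proj K v)"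
    have z: "z \<in> Rvec d" using K by (simp add: z_def vscale_in_Rvec proj_in_Rvec)
    have pz: "proj K z = z" by (auto simp: z_def vscale_def proj_def)
    have nz: "norm2 d z = 1"
      unfolding z_def norm2_vscale norm2_proj[OF K] using n by (simp add: n_def[symmetric])
    have "ereal (quad d (H b) z) \<in> sparse_forms d bstar H (2 * s + 2 * k) r"
      unfolding sparse_forms_def
      by (rule CollectI, rule exI[of _ z], rule exI[of _ K], rule exI[of _ b])
        (use z pz nz b K card in \<open>simp add: quad_def\<close>)
    then have "rho_minus d bstar H (2 * s + 2 * k) r \<le> ereal (quad d (H b) z)"
      and "ereal (quad d (H b) z) \<le> rho_plus d bstar H (2 * s + 2 * k) r"
      unfolding rho_minus_def rho_plus_def by (auto intro: Inf_lower Sup_upper)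
    then have "rlo \<le> quad d (H b) z" "quad d (H b) z \<le> rhi"
      using lo hi by (meson ereal_less_eq(3) order_trans)+
    moreover have "quad d (H b) z = quad d (H b) (proj K v) / n\<^sup>2"
      by (simp add: z_def quad_vscale power_divide)
    ultimately show ?thesis using n by (simp add: n_def[symmetric] field_simps)
  qed
  show ?thesis by (rule that[of k]) (use k bounds in \<open>auto simp: s_def\<close>)
qed

text \<open>
  All points between \<open>bstar\<close> and \<open>bstar + v\<close> lie in the ball, so the Hessian form in direction \<open>v\<close>
  is at least \<open>(rlo/2)\<parallel>v\<parallel>\<^sub>2\<^sup>2\<close> along the whole segment.
\<close>

lemma cone_strong_convexity:
  assumes loss: "smooth_convex_loss d bstar r L G H"
    and LSE: "LSE d bstar H rlo rhi (5000 * (rhi / rlo)) C r"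
    and rlo: "0 < rlo" "rlo \<le> rhi" and s: "s = card (supp d bstar)" "1 \<le> s"
    and bstar: "bstar \<in> Rvec d"
    and v: "v \<in> Rvec d" "norm2 d v \<le> r" and E: "E \<subseteq> {..<d}" "card E \<le> 2 * s"
    and cone: "(\<Sum>j\<in>{..<d} - E. \<bar>v j\<bar>) \<le> 5 * (\<Sum>j\<in>E. \<bar>v j\<bar>)"
  shows "rlo / 2 * (norm2 d v)\<^sup>2 \<le> dotp d (vsub (G (vadd bstar v)) (G bstar)) v"
proof -
  obtain k :: nat where k: "5000 * (rhi / rlo) * real s \<le> k"
    and bounds: "\<And>b v K. b \<in> vcball d bstar r \<Longrightarrow> K \<subseteq> {..<d} \<Longrightarrow> card K \<le> 2 * s + 2 * k \<Longrightarrow>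
      rlo * (L2_set v K)\<^sup>2 \<le> quad d (H b) (proj K v) \<and>
      quad d (H b) (proj K v) \<le> rhi * (L2_set v K)\<^sup>2"
    using LSE_sparse_bounds[OF LSE] s(1) by metis
  have ball: "vadd bstar (vscale t v) \<in> vcball d bstar r" if "0 \<le> t" "t \<le> 1" for t
  proof -
    have "vsub (vadd bstar (vscale t v)) bstar = vscale t v"
      by (simp add: vsub_def vadd_def)
    moreover have "t * norm2 d v \<le> 1 * norm2 d v"
      using that norm2_nonneg by (intro mult_right_mono) auto
    ultimately show ?thesis
      using that v bstar by (simp add: vcball_def vadd_in_Rvec vscale_in_Rvec norm2_vscale)
  qed
  show ?thesis
  proof (rule gradient_growth[where H = H])
    fix t :: real assume t: "0 \<le> t" "t \<le> 1"
    note b = ball[OF t]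
    show "has_jacobian d G (H (vadd bstar (vscale t v))) (vadd bstar (vscale t v))"
      using loss b by (simp add: smooth_convex_loss_def)
    show "rlo / 2 * (norm2 d v)\<^sup>2 \<le> quad d (H (vadd bstar (vscale t v))) v"
      by (rule quad_lower_bound_on_cone[where k = k and s = s and rhi = rhi and E = E])
        (use hessian_psd[OF loss b] bounds[OF b] rlo s k v E cone in auto)
  qed (rule v(1))
qed

section \<open>Approximate stationarity\<close>

text \<open>
  Changing only coordinate \<open>j\<close> isolates the subgradient inequality of the absolute value there.
  The values \<open>x\<^sub>j \<plusminus> 1\<close> give the bound on \<open>\<xi>\<^sub>j\<close>, the value \<open>0\<close> gives the sign.
\<close>

lemma subgradient_norm1_coord:
  assumes \<xi>: "\<xi> \<in> subdifferential d (norm1 d) x" and x: "x \<in> Rvec d" and j: "j < d"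
  shows "\<bar>\<xi> j\<bar> \<le> 1" "\<xi> j * x j = \<bar>x j\<bar>"
proof -
  have coord: "\<bar>x j\<bar> + \<xi> j * (a - x j) \<le> \<bar>a\<bar>" for a
  proof -
    define z where "z = x(j := a)"
    have "z \<in> Rvec d" using x j by (auto simp: z_def Rvec_def)
    then have "norm1 d x + dotp d \<xi> (vsub z x) \<le> norm1 d z"
      using \<xi> by (simp add: subdifferential_def)
    moreover have "dotp d \<xi> (vsub z x) = \<xi> j * (a - x j)"
    proof -
      have "dotp d \<xi> (vsub z x) = (\<Sum>i<d. if i = j then \<xi> j * (a - x j) else 0)"
        unfolding dotp_def by (rule sum.cong) (auto simp: z_def vsub_def)
      then show ?thesis using j by simp
    qed
    moreover have "norm1 d z - norm1 d x = \<bar>a\<bar> - \<bar>x j\<bar>"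
    proof -
      have "norm1 d z - norm1 d x = (\<Sum>i<d. if i = j then \<bar>a\<bar> - \<bar>x j\<bar> else 0)"
        unfolding norm1_def sum_subtractf[symmetric] by (rule sum.cong) (auto simp: z_def)
      then show ?thesis using j by simp
    qed
    ultimately show ?thesis by linarith
  qed
  show le1: "\<bar>\<xi> j\<bar> \<le> 1"
    using coord[of "x j + 1"] coord[of "x j - 1"] by (auto simp: abs_if split: if_splits)
  have "\<bar>x j\<bar> \<le> \<xi> j * x j" using coord[of 0] by simp
  moreover have "\<xi> j * x j \<le> \<bar>\<xi> j\<bar> * \<bar>x j\<bar>" by (metis abs_ge_self abs_mult)
  moreover have "\<bar>\<xi> j\<bar> * \<bar>x j\<bar> \<le> 1 * \<bar>x j\<bar>" by (intro mult_right_mono le1) simp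
  ultimately show "\<xi> j * x j = \<bar>x j\<bar>" by simp
qed

lemma sgn_in_subdifferential:
  assumes "x \<in> Rvec d"
  shows "(\<lambda>j. sgn (x j)) \<in> subdifferential d (norm1 d) x"
proof -
  have "norm1 d x + dotp d (\<lambda>j. sgn (x j)) (vsub z x) \<le> norm1 d z" for z
    unfolding norm1_def dotp_def sum.distrib[symmetric]
    by (rule sum_mono) (auto simp: vsub_def sgn_if abs_if)
  then show ?thesis using assms by (auto simp: subdifferential_def Rvec_def)
qed

text \<open>
  A tolerance \<open>e\<close> strictly above \<open>eps\<close> yields a subgradient directly from the infimum, which
  avoids a compactness argument for its attainment; the slack is removed in the next lemma, whose
  conclusion does not mention the subgradient.
\<close>

lemma eps_optimal_subgradient:
  assumes opt: "eps_optimal d G wt eps b" and "eps < e"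
  obtains \<xi> where "\<And>j. j < d \<Longrightarrow> \<bar>\<xi> j\<bar> \<le> 1" "\<And>j. j < d \<Longrightarrow> \<xi> j * b j = \<bar>b j\<bar>"
    "\<And>j. j < d \<Longrightarrow> \<bar>G b j + wt j * \<xi> j\<bar> \<le> e"
proof -
  have b: "b \<in> Rvec d" and "omega d G wt b < e"
    using opt \<open>eps < e\<close> by (auto simp: eps_optimal_def)
  then obtain \<xi> where \<xi>: "\<xi> \<in> subdifferential d (norm1 d) b"
    and ne: "norm_inf d (\<lambda>j. G b j + wt j * \<xi> j) < e"
    unfolding omega_def using sgn_in_subdifferential[OF b] by (auto dest!: cInf_lessD[rotated])
  show ?thesis
  proof (rule that[of \<xi>])
    fix j assume j: "j < d"
    show "\<bar>G b j + wt j * \<xi> j\<bar> \<le> e"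
      using abs_coord_le_norm_inf[OF j, of "\<lambda>j. G b j + wt j * \<xi> j"] ne by simp
  qed (use subgradient_norm1_coord[OF \<xi> b] in auto)
qed

text \<open>
  Write \<open>G b = e - wt \<odot> \<xi>\<close> with \<open>|e\<^sub>j| \<le> eps\<close> and estimate each coordinate of the scalar product with
  \<open>\<Delta>\<close>.  Outside \<open>S\<close> we have \<open>\<Delta>\<^sub>j = b\<^sub>j\<close>, so \<open>\<xi>\<^sub>j \<Delta>\<^sub>j = |\<Delta>\<^sub>j|\<close> and the penalty helps: it can be
  dropped on \<open>E - S\<close>, and outside \<open>E\<close> its weight \<open>lam/2\<close> beats the noise level \<open>lam/4\<close>.
\<close>

lemma basic_inequality:
  assumes opt: "eps_optimal d G wt eps b" and S: "S = supp d x"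
    and SE: "S \<subseteq> E" "E \<subseteq> {..<d}"
    and wt: "\<And>j. j < d \<Longrightarrow> 0 \<le> wt j" and wtE: "\<And>j. j \<in> {..<d} - E \<Longrightarrow> lam / 2 \<le> wt j"
    and grad: "norm_inf d (G x) + eps \<le> lam / 4"
  defines "\<Delta> \<equiv> vsub b x"
  shows "dotp d (vsub (G b) (G x)) \<Delta> \<le>
      (\<Sum>j\<in>S. (eps + \<bar>G x j\<bar> + wt j) * \<bar>\<Delta> j\<bar>) + lam / 4 * (\<Sum>j\<in>E - S. \<bar>\<Delta> j\<bar>)
      - lam / 4 * (\<Sum>j\<in>{..<d} - E. \<bar>\<Delta> j\<bar>)"
    (is "?D \<le> ?R")
proof (rule field_le_epsilon)
  fix \<epsilon> :: real assume \<epsilon>: "0 < \<epsilon>"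
  \<comment> \<open>Slack \<open>\<eta>\<close> in every coordinate costs \<open>\<eta>\<parallel>\<Delta>\<parallel>\<^sub>1\<close> in total.\<close>
  define \<eta> where "\<eta> = \<epsilon> / (norm1 d \<Delta> + 1)"
  have N: "0 \<le> norm1 d \<Delta>" by (simp add: norm1_def sum_nonneg)
  have \<eta>: "0 < \<eta>" "\<eta> * norm1 d \<Delta> \<le> \<epsilon>" using \<epsilon> N by (auto simp: \<eta>_def field_simps)
  obtain \<xi> where \<xi>: "\<And>j. j < d \<Longrightarrow> \<bar>\<xi> j\<bar> \<le> 1" "\<And>j. j < d \<Longrightarrow> \<xi> j * b j = \<bar>b j\<bar>"
    and e: "\<And>j. j < d \<Longrightarrow> \<bar>G b j + wt j * \<xi> j\<bar> \<le> eps + \<eta>"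
    using eps_optimal_subgradient[OF opt, of "eps + \<eta>"] \<eta> by auto
  define c where "c = (\<lambda>j. if j \<in> S then (eps + \<bar>G x j\<bar> + wt j) * \<bar>\<Delta> j\<bar>
     else if j \<in> E then lam / 4 * \<bar>\<Delta> j\<bar> else - (lam / 4 * \<bar>\<Delta> j\<bar>))"
  have term_le: "(G b j - G x j) * \<Delta> j \<le> c j + \<eta> * \<bar>\<Delta> j\<bar>" if j: "j < d" for j
  proof -
    have "(G b j - G x j) * \<Delta> j = (G b j + wt j * \<xi> j) * \<Delta> j - G x j * \<Delta> j - wt j * (\<xi> j * \<Delta> j)"
      by (simp add: algebra_simps)
    moreover have "(G b j + wt j * \<xi> j) * \<Delta> j \<le> (eps + \<eta>) * \<bar>\<Delta> j\<bar>"
      by (rule order_trans[OF abs_ge_self]) (simp add: abs_mult mult_right_mono e[OF j])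
    moreover have "- (G x j * \<Delta> j) \<le> \<bar>G x j\<bar> * \<bar>\<Delta> j\<bar>"
      by (metis abs_ge_minus_self abs_mult)
    ultimately have base: "(G b j - G x j) * \<Delta> j \<le>
        (eps + \<bar>G x j\<bar>) * \<bar>\<Delta> j\<bar> + \<eta> * \<bar>\<Delta> j\<bar> - wt j * (\<xi> j * \<Delta> j)"
      by (simp add: algebra_simps)
    show ?thesis
    proof (cases "j \<in> S")
      case True
      have "\<bar>\<xi> j * \<Delta> j\<bar> \<le> 1 * \<bar>\<Delta> j\<bar>"
        unfolding abs_mult by (intro mult_right_mono \<xi>(1) j) simp
      then have "wt j * (- (\<xi> j * \<Delta> j)) \<le> wt j * \<bar>\<Delta> j\<bar>"
        using wt[OF j] by (intro mult_left_mono) auto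
      then show ?thesis using base True by (simp add: c_def algebra_simps)
    next
      case False
      then have "x j = 0" using j S by (simp add: supp_def)
      then have "\<xi> j * \<Delta> j = \<bar>\<Delta> j\<bar>" using \<xi>(2)[OF j] by (simp add: \<Delta>_def vsub_def)
      moreover have "(eps + \<bar>G x j\<bar>) * \<bar>\<Delta> j\<bar> \<le> lam / 4 * \<bar>\<Delta> j\<bar>"
        using abs_coord_le_norm_inf[OF j, of "G x"] grad by (intro mult_right_mono) auto
      moreover have "0 \<le> wt j * \<bar>\<Delta> j\<bar>" using wt[OF j] by simp
      moreover have "lam / 2 * \<bar>\<Delta> j\<bar> \<le> wt j * \<bar>\<Delta> j\<bar>" if "j \<notin> E"
        using that j wtE by (intro mult_right_mono) auto
      ultimately show ?thesis using base False by (auto simp: c_def)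
    qed
  qed
  have "?D = (\<Sum>j<d. (G b j - G x j) * \<Delta> j)" by (simp add: dotp_def vsub_def)
  also have "\<dots> \<le> (\<Sum>j<d. c j + \<eta> * \<bar>\<Delta> j\<bar>)" by (intro sum_mono term_le) simp
  also have "\<dots> = sum c {..<d} + \<eta> * norm1 d \<Delta>"
    by (simp add: sum.distrib norm1_def sum_distrib_left)
  also have "sum c {..<d} = ?R"
  proof -
    have finE: "finite E" using SE finite_subset by blast
    have "sum c {..<d} = sum c ({..<d} - E) + (sum c (E - S) + sum c S)"
      using sum.subset_diff[OF SE(2), of c] sum.subset_diff[OF SE(1) finE, of c] by simp
    moreover have "sum c ({..<d} - E) = - (lam / 4 * (\<Sum>j\<in>{..<d} - E. \<bar>\<Delta> j\<bar>))"
      unfolding sum_distrib_left sum_negf[symmetric]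
      by (rule sum.cong) (use SE in \<open>auto simp: c_def\<close>)
    moreover have "sum c (E - S) = lam / 4 * (\<Sum>j\<in>E - S. \<bar>\<Delta> j\<bar>)"
      unfolding sum_distrib_left by (rule sum.cong) (auto simp: c_def)
    ultimately show ?thesis by (simp add: c_def)
  qed
  finally show "?D \<le> ?R + \<epsilon>" using \<eta> by linarith
qed

section \<open>Weights of the tightening class\<close>

text \<open>
  If \<open>|b\<^sub>j - x\<^sub>j| \<le> u\<close>, then \<open>|b\<^sub>j| \<ge> |x\<^sub>j| - u\<close> and monotonicity of \<open>w\<close> bounds the weight at \<open>b\<^sub>j\<close>;
  otherwise the weight is at most \<open>1 \<le> |b\<^sub>j - x\<^sub>j|/u\<close>.
\<close>

lemma L2_set_tightened_weights:
  assumes w: "w \<in> tightening" and u: "0 < u"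
  shows "L2_set (\<lambda>j. w \<bar>b j\<bar>) A \<le> L2_set (\<lambda>j. w (\<bar>x j\<bar> - u)) A + L2_set (vsub b x) A / u"
proof -
  have mono: "\<And>t1 t2. t2 \<le> t1 \<Longrightarrow> 0 \<le> t2 \<Longrightarrow> w t1 \<le> w t2"
    and bd: "\<And>t. 0 \<le> t \<Longrightarrow> 0 \<le> w t \<and> w t \<le> 1" and one: "\<And>t. t \<le> 0 \<Longrightarrow> w t = 1"
    using w by (auto simp: tightening_def)
  have w0: "0 \<le> w t" for t using bd[of t] one[of t] by (cases "0 \<le> t") auto
  have "w \<bar>b j\<bar> \<le> w (\<bar>x j\<bar> - u) + \<bar>vsub b x j\<bar> / u" for j
  proof (cases "\<bar>vsub b x j\<bar> \<le> u")
    case True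
    then have "\<bar>x j\<bar> - u \<le> \<bar>b j\<bar>" by (auto simp: vsub_def)
    then have "w \<bar>b j\<bar> \<le> w (\<bar>x j\<bar> - u)"
      using mono[of "\<bar>x j\<bar> - u" "\<bar>b j\<bar>"] one[of "\<bar>x j\<bar> - u"] bd[of "\<bar>b j\<bar>"]
      by (cases "0 \<le> \<bar>x j\<bar> - u") auto
    moreover have "0 \<le> \<bar>vsub b x j\<bar> / u" using u by simp
    ultimately show ?thesis by linarith
  next
    case False
    then have "1 \<le> \<bar>vsub b x j\<bar> / u" using u by simp
    then show ?thesis using bd[of "\<bar>b j\<bar>"] w0[of "\<bar>x j\<bar> - u"] by simp
  qed
  then have "L2_set (\<lambda>j. w \<bar>b j\<bar>) A \<le> L2_set (\<lambda>j. w (\<bar>x j\<bar> - u) + \<bar>vsub b x j\<bar> / u) A"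
    by (intro L2_set_mono w0)
  also have "\<dots> \<le> L2_set (\<lambda>j. w (\<bar>x j\<bar> - u)) A + L2_set (\<lambda>j. \<bar>vsub b x j\<bar> / u) A"
    by (rule L2_set_triangle_ineq)
  also have "L2_set (\<lambda>j. \<bar>vsub b x j\<bar> / u) A = L2_set (vsub b x) A / u"
    using u by (simp add: L2_set_def power_divide sum_divide_distrib[symmetric] real_sqrt_divide)
  finally show ?thesis .
qed

lemma sqrt_card_le_L2_set:
  fixes v :: "'a \<Rightarrow> real"
  assumes "\<And>j. j \<in> A \<Longrightarrow> u \<le> \<bar>v j\<bar>" "0 < u"
  shows "sqrt (card A) \<le> L2_set v A / u"
proof -
  have "card A * u\<^sup>2 \<le> (\<Sum>j\<in>A. (v j)\<^sup>2)"
    by (rule sum_bounded_below) (use assms in \<open>metis abs_le_square_iff abs_of_pos\<close>)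
  then have "sqrt (card A * u\<^sup>2) \<le> L2_set v A" unfolding L2_set_def by (rule real_sqrt_le_mono)
  then show ?thesis using assms(2) by (simp add: real_sqrt_mult pos_le_divide_eq)
qed

section \<open>Error of one weighted problem\<close>

text \<open>
  The data common to all steps of the iteration.  The constants \<open>5000\<close> and \<open>1/4\<close> are the choices of
  \<open>cLSE\<close> and \<open>c0\<close>: the former feeds the curvature estimate, the latter keeps solutions in the ball.
\<close>

locale lse_loss =
  fixes d :: nat and bstar :: vec and r :: real and L :: "vec \<Rightarrow> real" and G :: "vec \<Rightarrow> vec"
    and H :: "vec \<Rightarrow> nat \<Rightarrow> nat \<Rightarrow> real" and rlo rhi CLSE lam :: real and S :: "nat set" and s :: nat
  assumes loss: "smooth_convex_loss d bstar r L G H"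
    and LSE: "LSE d bstar H rlo rhi (5000 * (rhi / rlo)) CLSE r"
    and rlo: "0 < rlo" "rlo \<le> rhi"
    and bstar: "bstar \<in> Rvec d" and S_def: "S = supp d bstar" and s_def: "s = card S"
    and s_pos: "1 \<le> s" and lam_pos: "0 < lam" and lam_le: "lam * sqrt s \<le> rlo / 4 * r"
begin

lemma S_subset: "S \<subseteq> {..<d}"
  by (auto simp: S_def supp_def)

text \<open>
  The gradient difference along \<open>\<Delta>\<close> is at most \<open>K\<parallel>\<Delta>\<parallel>\<^sub>2\<close> by the basic inequality and
  Cauchy--Schwarz, and at least \<open>(rlo/2)\<parallel>\<Delta>\<parallel>\<^sub>2\<^sup>2\<close> by curvature on the cone.  The second claim,
  \<open>3/2 = 1 + 1/4 + 1/4\<close>, collects the weights, the noise on \<open>S\<close> and the noise on \<open>E - S\<close>.  It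
  serves both to keep the solution in the ball and to continue the induction over the steps.
\<close>

lemma weighted_solution_error:
  assumes opt: "eps_optimal d G wt eps b" and eps: "0 \<le> eps"
    and grad: "norm_inf d (G bstar) + eps \<le> lam / 4"
    and wt: "\<And>j. j < d \<Longrightarrow> 0 \<le> wt j \<and> wt j \<le> lam"
    and E: "S \<subseteq> E" "E \<subseteq> {..<d}" and cardE: "card (E - S) \<le> s"
    and wtE: "\<And>j. j \<in> {..<d} - E \<Longrightarrow> lam / 2 \<le> wt j"
  defines "K \<equiv> norm2 d (proj S (G bstar)) + eps * sqrt s + L2_set wt S
                + lam / 4 * sqrt (card (E - S))"
  shows "rlo / 2 * norm2 d (vsub b bstar) \<le> K" and "K \<le> 3 / 2 * (lam * sqrt s)"
proof -
  define \<Delta> where "\<Delta> = vsub b bstar"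
  define N where "N = norm2 d \<Delta>"
  define D where "D = dotp d (vsub (G b) (G bstar)) \<Delta>"
  have b: "b \<in> Rvec d" using opt by (simp add: eps_optimal_def)
  have \<Delta>: "\<Delta> \<in> Rvec d" using b bstar by (simp add: \<Delta>_def vsub_in_Rvec)
  have b_eq: "vadd bstar \<Delta> = b" by (simp add: \<Delta>_def vadd_def vsub_def)
  have N: "0 \<le> N" by (simp add: N_def norm2_nonneg)
  have finE: "finite E" using E finite_subset by blast
  have D_le: "D \<le> (\<Sum>j\<in>S. (eps + \<bar>G bstar j\<bar> + wt j) * \<bar>\<Delta> j\<bar>) + lam / 4 * (\<Sum>j\<in>E - S. \<bar>\<Delta> j\<bar>)
      - lam / 4 * (\<Sum>j\<in>{..<d} - E. \<bar>\<Delta> j\<bar>)"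
    unfolding D_def \<Delta>_def by (rule basic_inequality) (use opt S_def E wt wtE grad in auto)
  have D0: "0 \<le> D" unfolding D_def \<Delta>_def by (rule gradient_monotone[OF loss bstar b])

  have g_le: "\<bar>G bstar j\<bar> \<le> lam / 4 - eps" if "j < d" for j
    using abs_coord_le_norm_inf[OF that, of "G bstar"] grad by simp
  show K_le: "K \<le> 3 / 2 * (lam * sqrt s)"
  proof -
    have "0 < d" using s_pos s_def S_subset by (cases d) auto
    then have gi: "0 \<le> lam / 4 - eps" using order_trans[OF abs_ge_zero g_le] by blast
    have "norm2 d (proj S (G bstar)) \<le> sqrt s * (lam / 4 - eps)"
      unfolding norm2_proj[OF S_subset] s_def
      by (rule L2_set_const_bound) (use g_le S_subset gi in auto)
    moreover have "L2_set wt S \<le> sqrt s * lam"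
      unfolding s_def by (rule L2_set_const_bound) (use wt S_subset lam_pos in auto)
    moreover have "lam / 4 * sqrt (card (E - S)) \<le> lam / 4 * sqrt s"
      using cardE lam_pos by (intro mult_left_mono) auto
    ultimately show ?thesis by (simp add: K_def algebra_simps)
  qed

  have cone: "(\<Sum>j\<in>{..<d} - E. \<bar>\<Delta> j\<bar>) \<le> 5 * (\<Sum>j\<in>E. \<bar>\<Delta> j\<bar>)"
  proof -
    have "(\<Sum>j\<in>S. (eps + \<bar>G bstar j\<bar> + wt j) * \<bar>\<Delta> j\<bar>) \<le> (\<Sum>j\<in>S. 5 / 4 * lam * \<bar>\<Delta> j\<bar>)"
      by (intro sum_mono mult_right_mono) (use g_le wt S_subset in fastforce)+
    also have "\<dots> = 5 / 4 * lam * (\<Sum>j\<in>S. \<bar>\<Delta> j\<bar>)" by (simp only: sum_distrib_left)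
    finally have "(\<Sum>j\<in>S. (eps + \<bar>G bstar j\<bar> + wt j) * \<bar>\<Delta> j\<bar>) \<le> 5 / 4 * lam * (\<Sum>j\<in>S. \<bar>\<Delta> j\<bar>)" .
    moreover have "lam / 4 * (\<Sum>j\<in>E - S. \<bar>\<Delta> j\<bar>) \<le> 5 / 4 * lam * (\<Sum>j\<in>E - S. \<bar>\<Delta> j\<bar>)"
      using lam_pos by (intro mult_right_mono) (auto simp: sum_nonneg)
    moreover have "5 / 4 * lam * (\<Sum>j\<in>E. \<bar>\<Delta> j\<bar>)
        = 5 / 4 * lam * (\<Sum>j\<in>E - S. \<bar>\<Delta> j\<bar>) + 5 / 4 * lam * (\<Sum>j\<in>S. \<bar>\<Delta> j\<bar>)"
      by (simp only: sum.subset_diff[OF E(1) finE] distrib_left)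
    ultimately have "lam / 4 * (\<Sum>j\<in>{..<d} - E. \<bar>\<Delta> j\<bar>) \<le> lam / 4 * (5 * (\<Sum>j\<in>E. \<bar>\<Delta> j\<bar>))"
      using D_le D0 by linarith
    then show ?thesis using lam_pos by simp
  qed

  have D_KN: "D \<le> K * N"
  proof -
    have LS: "L2_set \<Delta> S \<le> N" unfolding N_def by (rule L2_set_le_norm2[OF S_subset])
    have LE: "L2_set \<Delta> (E - S) \<le> N" unfolding N_def by (rule L2_set_le_norm2) (use E in auto)
    have "(\<Sum>j\<in>S. \<bar>\<Delta> j\<bar>) \<le> sqrt s * N"
      using sum_abs_le_sqrt_card_L2[of \<Delta> S] mult_left_mono[OF LS, of "sqrt s"] by (simp add: s_def)
    then have 1: "eps * (\<Sum>j\<in>S. \<bar>\<Delta> j\<bar>) \<le> eps * sqrt s * N"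
      using eps by (simp add: mult_left_mono mult.assoc)
    have 2: "(\<Sum>j\<in>S. \<bar>G bstar j\<bar> * \<bar>\<Delta> j\<bar>) \<le> norm2 d (proj S (G bstar)) * N"
      unfolding norm2_proj[OF S_subset]
      by (rule order_trans[OF L2_set_mult_ineq mult_left_mono[OF LS]]) simp
    have "(\<Sum>j\<in>S. wt j * \<bar>\<Delta> j\<bar>) = (\<Sum>j\<in>S. \<bar>wt j\<bar> * \<bar>\<Delta> j\<bar>)"
      by (rule sum.cong) (use wt S_subset in auto)
    also have "\<dots> \<le> L2_set wt S * N"
      by (rule order_trans[OF L2_set_mult_ineq mult_left_mono[OF LS]]) simp
    finally have 3: "(\<Sum>j\<in>S. wt j * \<bar>\<Delta> j\<bar>) \<le> L2_set wt S * N" .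
    have "(\<Sum>j\<in>E - S. \<bar>\<Delta> j\<bar>) \<le> sqrt (card (E - S)) * N"
      using sum_abs_le_sqrt_card_L2[of \<Delta> "E - S"] mult_left_mono[OF LE, of "sqrt (card (E - S))"]
      by simp
    then have 4: "lam / 4 * (\<Sum>j\<in>E - S. \<bar>\<Delta> j\<bar>) \<le> lam / 4 * sqrt (card (E - S)) * N"
      unfolding mult.assoc using lam_pos by (intro mult_left_mono) auto
    have 5: "0 \<le> lam / 4 * (\<Sum>j\<in>{..<d} - E. \<bar>\<Delta> j\<bar>)"
      using lam_pos by (simp add: sum_nonneg)
    have "(\<Sum>j\<in>S. (eps + \<bar>G bstar j\<bar> + wt j) * \<bar>\<Delta> j\<bar>) =
        eps * (\<Sum>j\<in>S. \<bar>\<Delta> j\<bar>) + (\<Sum>j\<in>S. \<bar>G bstar j\<bar> * \<bar>\<Delta> j\<bar>) + (\<Sum>j\<in>S. wt j * \<bar>\<Delta> j\<bar>)"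
      by (simp add: distrib_right sum.distrib sum_distrib_left)
    then show ?thesis
      using D_le 1 2 3 4 5 by (simp add: K_def distrib_right)
  qed

  have r0: "0 < r"
  proof -
    have "0 < lam * sqrt s" using lam_pos s_pos by simp
    then show ?thesis using lam_le rlo by (smt (verit) zero_less_mult_iff divide_pos_pos)
  qed
  have cardE2: "card E \<le> 2 * s"
  proof -
    have "card E = card (E - S) + card S"
      using card_Diff_subset[of S E] E finE card_mono[OF finE E(1)] finite_subset by fastforce
    then show ?thesis using cardE s_def by simp
  qed
  have curvature: "rlo / 2 * (c * N)\<^sup>2 \<le> c * dotp d (vsub (G (vadd bstar (vscale c \<Delta>))) (G bstar)) \<Delta>"
    if c: "0 \<le> c" "c * N \<le> r" for c
  proof -
    have cone_c: "(\<Sum>j\<in>{..<d} - E. \<bar>vscale c \<Delta> j\<bar>) \<le> 5 * (\<Sum>j\<in>E. \<bar>vscale c \<Delta> j\<bar>)"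
      using mult_left_mono[OF cone c(1)] c(1)
      by (simp add: vscale_def abs_mult sum_distrib_left[symmetric] mult.left_commute)
    have "rlo / 2 * (norm2 d (vscale c \<Delta>))\<^sup>2
        \<le> dotp d (vsub (G (vadd bstar (vscale c \<Delta>))) (G bstar)) (vscale c \<Delta>)"
      by (rule cone_strong_convexity[OF loss LSE rlo _ s_pos bstar vscale_in_Rvec[OF \<Delta>] _ E(2) cardE2 cone_c])
        (use c in \<open>auto simp: norm2_vscale N_def s_def S_def\<close>)
    then show ?thesis using c by (simp add: norm2_vscale dotp_vscale_right N_def)
  qed
  \<comment> \<open>Were \<open>\<Delta>\<close> too long, its rescaling to length \<open>r\<close> would still lie in the cone, and the gradient
    difference there is at most the one at \<open>b\<close>, by monotonicity along the ray.\<close>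
  have "N \<le> r"
  proof (rule ccontr)
    assume "\<not> N \<le> r"
    then have Nr: "r < N" by simp
    define c where "c = r / N"
    have N0: "0 < N" using Nr r0 by simp
    have c: "0 < c" "c \<le> 1" "c * N = r" using Nr r0 N0 by (auto simp: c_def)
    have v1: "vadd bstar (vscale 1 \<Delta>) = b" using b_eq by (simp add: vscale_def)
    have "dotp d (vsub (G (vadd bstar (vscale c \<Delta>))) (G bstar)) \<Delta> \<le> D"
      using monoD[OF gradient_along_line_mono[OF loss bstar \<Delta>] c(2)]
      by (simp add: v1 D_def dotp_vsub_left)
    then have "c * dotp d (vsub (G (vadd bstar (vscale c \<Delta>))) (G bstar)) \<Delta> \<le> c * D"
      using c by (intro mult_left_mono) auto
    moreover have "rlo / 2 * r\<^sup>2
        \<le> c * dotp d (vsub (G (vadd bstar (vscale c \<Delta>))) (G bstar)) \<Delta>"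
      using curvature[of c] c by simp
    ultimately have "rlo / 2 * r\<^sup>2 \<le> c * D" by linarith
    also have "\<dots> \<le> c * (K * N)" using D_KN c by (intro mult_left_mono) auto
    also have "\<dots> = K * r" using c(3) by (simp add: mult.left_commute mult.commute)
    finally have "(rlo / 2 * r) * r \<le> K * r" by (simp add: power2_eq_square mult.assoc)
    \<comment> \<open>The radius condition on \<open>lam\<close> makes \<open>K\<close> at most \<open>(3/8) rlo r\<close>, less than \<open>(1/2) rlo r\<close>.\<close>
    then have "rlo / 2 * r \<le> K" using r0 by simp
    also have "\<dots> \<le> 3 / 2 * (rlo / 4 * r)" using K_le lam_le by simp
    finally have "rlo * r \<le> 0" by (simp add: mult.commute)
    then show False using mult_pos_pos[OF rlo(1) r0] by simp
  qed
  then have "rlo / 2 * N\<^sup>2 \<le> D"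
    using curvature[of 1] b_eq by (simp add: D_def vscale_def)
  then have "(rlo / 2 * N) * N \<le> K * N"
    using D_KN by (simp add: power2_eq_square mult.assoc)
  moreover have "0 \<le> K"
  proof -
    have "0 \<le> eps * sqrt s" "0 \<le> lam / 4 * sqrt (card (E - S))" using eps lam_pos by auto
    then show ?thesis unfolding K_def by (simp add: norm2_nonneg add_nonneg_nonneg)
  qed
  ultimately show "rlo / 2 * norm2 d (vsub b bstar) \<le> K"
    using N unfolding N_def[symmetric] \<Delta>_def[symmetric] by (cases "N = 0") auto
qed

section \<open>Contraction under reweighting\<close>

text \<open>
  The previous error enters \<open>K\<close> twice: through the weights on \<open>S\<close> with factor \<open>lam/u\<close>, and through
  \<open>\<surd>|E - S|\<close> with factor \<open>(1/4) lam/u\<close>, because \<open>w u \<ge> 1/2\<close> forces a coordinate of small weight to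
  exceed \<open>u\<close>.  After division by \<open>rlo/2\<close> the factor is \<open>(5/4)\<cdot>2\<delta>/18 = 5\<delta>/36\<close>, below \<open>\<delta>\<close>.
\<close>

lemma reweighted_solution_error:
  assumes w: "w \<in> tightening" and \<delta>: "0 < \<delta>" "\<delta> < 1"
    and u: "u = 18 * inverse rlo * inverse \<delta> * lam" "1 / 2 \<le> w u"
    and eps: "0 \<le> eps" and grad: "norm_inf d (G bstar) + eps \<le> lam / 4"
    and prev: "b0 \<in> Rvec d" "norm2 d (vsub b0 bstar) \<le> 3 / rlo * (lam * sqrt s)"
    and opt: "eps_optimal d G (\<lambda>j. lam * w \<bar>b0 j\<bar>) eps b"
  shows "norm2 d (vsub b bstar) \<le> 2 / rlo * (norm2 d (proj S (G bstar)) + eps * sqrt s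
           + lam * L2_set (\<lambda>j. w (\<bar>bstar j\<bar> - u)) S) + \<delta> * norm2 d (vsub b0 bstar)"
    and "norm2 d (vsub b bstar) \<le> 3 / rlo * (lam * sqrt s)"
proof -
  define P where "P = norm2 d (vsub b0 bstar)"
  define E where "E = S \<union> {j. j < d \<and> w \<bar>b0 j\<bar> < 1 / 2}"
  have u0: "0 < u" using u rlo \<delta> lam_pos by simp
  have lam_u: "lam / u = rlo * \<delta> / 18" unfolding u(1) using rlo \<delta> lam_pos by (simp add: field_simps)
  have P0: "0 \<le> P" by (simp add: P_def norm2_nonneg)
  have wbd: "0 \<le> w \<bar>t\<bar>" "w \<bar>t\<bar> \<le> 1" for t using w by (auto simp: tightening_def)
  have ES: "E - S \<subseteq> {..<d}" by (auto simp: E_def)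
  have far: "u \<le> \<bar>vsub b0 bstar j\<bar>" if "j \<in> E - S" for j
  proof -
    have "bstar j = 0" "w \<bar>b0 j\<bar> < 1 / 2" using that by (auto simp: E_def S_def supp_def)
    moreover have "u < \<bar>b0 j\<bar>"
    proof (rule ccontr)
      assume "\<not> u < \<bar>b0 j\<bar>"
      then have "w u \<le> w \<bar>b0 j\<bar>" using w by (simp add: tightening_def)
      then show False using u(2) calculation(2) by simp
    qed
    ultimately show ?thesis by (simp add: vsub_def)
  qed
  have sq: "sqrt (card (E - S)) \<le> P / u"
    using sqrt_card_le_L2_set[of "E - S" u "vsub b0 bstar"] far u0
      divide_right_mono[OF L2_set_le_norm2[OF ES, of "vsub b0 bstar"], of u]
    by (simp add: P_def)
  have "P / u \<le> 3 / rlo * (lam * sqrt s) / u" using divide_right_mono[OF prev(2), of u] u0 unfolding P_def by simp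
  also have "\<dots> = 3 / rlo * sqrt s * (lam / u)" by simp
  also have "\<dots> = \<delta> / 6 * sqrt s" unfolding lam_u using rlo by (simp add: field_simps)
  also have "\<dots> \<le> 1 * sqrt s" using \<delta> by (intro mult_right_mono) auto
  finally have "sqrt (card (E - S)) \<le> sqrt s" using sq by linarith
  then have cardE: "card (E - S) \<le> s" by simp
  have E: "S \<subseteq> E" "E \<subseteq> {..<d}" using S_subset by (auto simp: E_def)
  have wt: "0 \<le> lam * w \<bar>b0 j\<bar> \<and> lam * w \<bar>b0 j\<bar> \<le> lam" for j
    using wbd[of "b0 j"] lam_pos by (simp add: mult_left_le)
  have wtE: "lam / 2 \<le> lam * w \<bar>b0 j\<bar>" if "j \<in> {..<d} - E" for j
    using that lam_pos by (auto simp: E_def)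
  note err = weighted_solution_error[OF opt eps grad wt E cardE wtE, simplified]
  have "L2_set (\<lambda>j. lam * w \<bar>b0 j\<bar>) S = lam * L2_set (\<lambda>j. w \<bar>b0 j\<bar>) S"
    using L2_set_right_distrib[of lam "\<lambda>j. w \<bar>b0 j\<bar>" S] lam_pos by simp
  also have "\<dots> \<le> lam * (L2_set (\<lambda>j. w (\<bar>bstar j\<bar> - u)) S + P / u)"
  proof (rule mult_left_mono)
    show "L2_set (\<lambda>j. w \<bar>b0 j\<bar>) S \<le> L2_set (\<lambda>j. w (\<bar>bstar j\<bar> - u)) S + P / u"
      using L2_set_tightened_weights[OF w u0, of b0 S bstar]
        divide_right_mono[OF L2_set_le_norm2[OF S_subset, of "vsub b0 bstar"], of u] u0
      by (simp add: P_def)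
  qed (use lam_pos in simp)
  finally have weights: "L2_set (\<lambda>j. lam * w \<bar>b0 j\<bar>) S
      \<le> lam * L2_set (\<lambda>j. w (\<bar>bstar j\<bar> - u)) S + lam / u * P" by (simp add: distrib_left)
  have tail: "lam / 4 * sqrt (card (E - S)) \<le> 1 / 4 * (lam / u * P)"
    using mult_left_mono[OF sq, of "lam / 4"] lam_pos by simp
  define A where "A = norm2 d (proj S (G bstar)) + eps * sqrt s
           + lam * L2_set (\<lambda>j. w (\<bar>bstar j\<bar> - u)) S"
  have "rlo / 2 * norm2 d (vsub b bstar) \<le> A + 5 / 4 * (rlo * \<delta> / 18 * P)"
    using err(1) weights tail unfolding lam_u A_def by linarith
  also have "\<dots> \<le> A + rlo / 2 * (\<delta> * P)"
    using rlo \<delta> P0 by (simp add: mult_right_mono)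
  finally have "2 / rlo * (rlo / 2 * norm2 d (vsub b bstar)) \<le> 2 / rlo * (A + rlo / 2 * (\<delta> * P))"
    using rlo by (intro mult_left_mono) auto
  then show "norm2 d (vsub b bstar) \<le> 2 / rlo * (norm2 d (proj S (G bstar)) + eps * sqrt s
           + lam * L2_set (\<lambda>j. w (\<bar>bstar j\<bar> - u)) S) + \<delta> * norm2 d (vsub b0 bstar)"
    using rlo by (simp add: A_def P_def distrib_left)
  have "rlo / 2 * norm2 d (vsub b bstar) \<le> 3 / 2 * (lam * sqrt s)" using err by linarith
  then show "norm2 d (vsub b bstar) \<le> 3 / rlo * (lam * sqrt s)"
    using rlo by (simp add: field_simps)
qed

text \<open>
  The first step has constant weight \<open>lam\<close>, so \<open>E = S\<close> works there.  The fixed point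
  \<open>2A/(rlo (1 - \<delta>))\<close> of the recursion \<open>x \<mapsto> 2A/rlo + \<delta> x\<close> is the constant part of the second bound.
\<close>

lemma iterates_error:
  assumes w: "w \<in> tightening" and \<delta>: "0 < \<delta>" "\<delta> < 1"
    and u: "u = 18 * inverse rlo * inverse \<delta> * lam" "1 / 2 \<le> w u"
    and eps: "0 \<le> epsc" "0 \<le> epst"
    and grad: "4 * (norm_inf d (G bstar) + max epst epsc) \<le> lam"
    and sol: "approx_solutions d G w lam epsc epst B"
  defines "A \<equiv> norm2 d (proj S (G bstar)) + epst * sqrt s
                + lam * L2_set (\<lambda>j. w (\<bar>bstar j\<bar> - u)) S"
  shows "norm2 d (vsub (B (Suc (Suc n))) bstar)
           \<le> 2 / rlo * A + \<delta> * norm2 d (vsub (B (Suc n)) bstar)"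
    and "norm2 d (vsub (B (Suc n)) bstar)
           \<le> 2 / (rlo * (1 - \<delta>)) * A + \<delta> ^ n * (3 / rlo * (lam * sqrt s))"
proof -
  have opt: "eps_optimal d G (\<lambda>j. lam * w \<bar>B m j\<bar>) (if m = 0 then epsc else epst) (B (Suc m))" for m
    using sol unfolding approx_solutions_def by (auto dest: spec[of _ "Suc m"])
  have B0: "B 0 = (\<lambda>j. 0)" using sol by (simp add: approx_solutions_def)
  have BR: "B (Suc m) \<in> Rvec d" for m using opt[of m] by (simp add: eps_optimal_def)
  have gc: "norm_inf d (G bstar) + epsc \<le> lam / 4" and gt: "norm_inf d (G bstar) + epst \<le> lam / 4"
    using grad by auto
  \<comment> \<open>The initial point gives every coordinate the full weight.\<close>
  have w0: "w 0 = 1" using w by (simp add: tightening_def)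
  have first: "norm2 d (vsub (B (Suc 0)) bstar) \<le> 3 / rlo * (lam * sqrt s)"
  proof -
    have "eps_optimal d G (\<lambda>j. lam) epsc (B (Suc 0))" using opt[of 0] by (simp add: B0 w0)
    note err = weighted_solution_error[OF this eps(1) gc _ subset_refl S_subset]
    have "rlo / 2 * norm2 d (vsub (B (Suc 0)) bstar) \<le> 3 / 2 * (lam * sqrt s)"
      by (rule order_trans[OF err]) (use lam_pos in auto)
    then show ?thesis using rlo by (simp add: field_simps)
  qed
  have crude: "norm2 d (vsub (B (Suc m)) bstar) \<le> 3 / rlo * (lam * sqrt s)" for m
  proof (induction m)
    case (Suc m)
    then show ?case
      using reweighted_solution_error(2)[OF w \<delta> u eps(2) gt BR Suc.IH] opt[of "Suc m"] by simp
  qed (rule first)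
  show step: "norm2 d (vsub (B (Suc (Suc n))) bstar)
      \<le> 2 / rlo * A + \<delta> * norm2 d (vsub (B (Suc n)) bstar)" for n
    unfolding A_def
    using reweighted_solution_error(1)[OF w \<delta> u eps(2) gt BR crude, of n] opt[of "Suc n"] by simp
  have A0: "0 \<le> A"
    unfolding A_def using eps lam_pos by (simp add: norm2_nonneg)
  show "norm2 d (vsub (B (Suc n)) bstar)
      \<le> 2 / (rlo * (1 - \<delta>)) * A + \<delta> ^ n * (3 / rlo * (lam * sqrt s))"
  proof (induction n)
    case 0
    have "0 \<le> 2 / (rlo * (1 - \<delta>)) * A" using A0 rlo \<delta> by simp
    then show ?case using first by simp
  next
    case (Suc n)
    have "norm2 d (vsub (B (Suc (Suc n))) bstar) \<le> 2 / rlo * A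
        + \<delta> * (2 / (rlo * (1 - \<delta>)) * A + \<delta> ^ n * (3 / rlo * (lam * sqrt s)))"
      by (rule order_trans[OF step add_left_mono[OF mult_left_mono[OF Suc.IH]]]) (use \<delta> in simp)
    also have "\<dots> = 2 / (rlo * (1 - \<delta>)) * A + \<delta> ^ Suc n * (3 / rlo * (lam * sqrt s))"
      using rlo \<delta> by (simp add: field_simps)
    finally show ?case .
  qed
qed

end

theorem theorem4p2:
  "\<exists>(CLSE :: real) (cLSE :: real \<Rightarrow> real \<Rightarrow> real) (c0 :: real \<Rightarrow> real)
      (C :: real \<Rightarrow> real \<Rightarrow> real) (C' :: real \<Rightarrow> real \<Rightarrow> real).
     CLSE > 0 \<and>
     (\<forall>rlo rhi. 0 < rlo \<and> rlo \<le> rhi \<longrightarrow> cLSE rlo rhi > 0) \<and>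
     (\<forall>rlo. 0 < rlo \<longrightarrow> c0 rlo > 0) \<and>
     (\<forall>rlo \<delta>. 0 < rlo \<and> 0 < \<delta> \<and> \<delta> < 1 \<longrightarrow> C rlo \<delta> > 0 \<and> C' rlo \<delta> > 0) \<and>
     (\<forall>(\<delta> :: real) (rlo :: real) (rhi :: real) (d :: nat) (bstar :: vec) (r :: real)
        (L :: vec \<Rightarrow> real) (G :: vec \<Rightarrow> vec) (H :: vec \<Rightarrow> nat \<Rightarrow> nat \<Rightarrow> real)
        (w :: real \<Rightarrow> real) (lam :: real) (epsc :: real) (epst :: real) (B :: nat \<Rightarrow> vec)
        (S :: nat set) (s :: nat) (u :: real).
        0 < \<delta> \<and> \<delta> < 1 \<and> 0 < rlo \<and> rlo \<le> rhi \<and>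
        bstar \<in> Rvec d \<and> S = supp d bstar \<and> s = card S \<and> s \<ge> 1 \<and>
        smooth_convex_loss d bstar r L G H \<and>
        LSE d bstar H rlo rhi (cLSE rlo rhi) CLSE r \<and>
        w \<in> tightening \<and>
        u = 18 * inverse rlo * inverse \<delta> * lam \<and> w u \<ge> 1 / 2 \<and>
        lam > 0 \<and> epsc \<ge> 0 \<and> epst \<ge> 0 \<and>
        4 * (norm_inf d (G bstar) + max epst epsc) \<le> lam \<and>
        lam \<le> c0 rlo * (r / sqrt (real s)) \<and>
        approx_solutions d G w lam epsc epst B
        \<longrightarrow>
        (\<forall>l\<ge>2.
          norm2 d (vsub (B l) bstar)
            \<le> C rlo \<delta> * (norm2 d (proj S (G bstar)) + epst * sqrt (real s)
                 + lam * L2_set (\<lambda>j. w (\<bar>bstar j\<bar> - u)) S)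
              + \<delta> * norm2 d (vsub (B (l - 1)) bstar) \<and>
          norm2 d (vsub (B l) bstar)
            \<le> C' rlo \<delta> * (norm2 d (proj S (G bstar)) + epst * sqrt (real s)
                 + lam * L2_set (\<lambda>j. w (\<bar>bstar j\<bar> - u)) S)
              + 2 * C' rlo \<delta> * \<delta> ^ (l - 1) * lam * sqrt (real s)))"
proof (rule exI[of _ 1], rule exI[of _ "\<lambda>rlo rhi. 5000 * (rhi / rlo)"],
    rule exI[of _ "\<lambda>rlo. rlo / 4"], rule exI[of _ "\<lambda>rlo \<delta>. 2 / rlo"],
    rule exI[of _ "\<lambda>rlo \<delta>. 2 / (rlo * (1 - \<delta>))"], intro conjI allI impI)
  \<comment> \<open>In this order the witnesses are \<open>CLSE\<close>, \<open>cLSE\<close>, \<open>c0\<close>, \<open>C\<close> and \<open>C'\<close>.\<close>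
  fix \<delta> rlo rhi :: real and d :: nat and bstar :: vec and r :: real and L :: "vec \<Rightarrow> real"
    and G :: "vec \<Rightarrow> vec" and H :: "vec \<Rightarrow> nat \<Rightarrow> nat \<Rightarrow> real" and w :: "real \<Rightarrow> real"
    and lam epsc epst :: real and B :: "nat \<Rightarrow> vec" and S :: "nat set" and s :: nat and u :: real
    and l :: nat
  assume "0 < \<delta> \<and> \<delta> < 1 \<and> 0 < rlo \<and> rlo \<le> rhi \<and>
        bstar \<in> Rvec d \<and> S = supp d bstar \<and> s = card S \<and> s \<ge> 1 \<and>
        smooth_convex_loss d bstar r L G H \<and>
        LSE d bstar H rlo rhi (5000 * (rhi / rlo)) 1 r \<and>
        w \<in> tightening \<and>
        u = 18 * inverse rlo * inverse \<delta> * lam \<and> w u \<ge> 1 / 2 \<and>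
        lam > 0 \<and> epsc \<ge> 0 \<and> epst \<ge> 0 \<and>
        4 * (norm_inf d (G bstar) + max epst epsc) \<le> lam \<and>
        lam \<le> rlo / 4 * (r / sqrt (real s)) \<and>
        approx_solutions d G w lam epsc epst B"
  then have \<delta>: "0 < \<delta>" "\<delta> < 1" and rlo: "0 < rlo" "rlo \<le> rhi"
    and bstar: "bstar \<in> Rvec d" and S: "S = supp d bstar" "s = card S" "1 \<le> s"
    and loss: "smooth_convex_loss d bstar r L G H"
    and LSE: "LSE d bstar H rlo rhi (5000 * (rhi / rlo)) 1 r"
    and w: "w \<in> tightening"
    and u: "u = 18 * inverse rlo * inverse \<delta> * lam" "w u \<ge> 1 / 2"
    and lam: "0 < lam" and eps: "0 \<le> epsc" "0 \<le> epst"
    and grad: "4 * (norm_inf d (G bstar) + max epst epsc) \<le> lam"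
    and radius: "lam \<le> rlo / 4 * (r / sqrt (real s))"
    and sol: "approx_solutions d G w lam epsc epst B"
    by iprover+
  assume "2 \<le> l"
  then obtain n where l: "l = Suc (Suc n)" using that[of "l - 2"] by simp
  have "lam \<le> rlo / 4 * r / sqrt s" "0 < sqrt s" using radius S(3) by auto
  then have radius': "lam * sqrt s \<le> rlo / 4 * r" by (simp only: pos_le_divide_eq)
  have setting: "lse_loss d bstar r L G H rlo rhi 1 lam S s"
    by (rule lse_loss.intro[OF loss LSE rlo bstar S lam radius'])
  define A where "A = norm2 d (proj S (G bstar)) + epst * sqrt s
      + lam * L2_set (\<lambda>j. w (\<bar>bstar j\<bar> - u)) S"
  note errors = lse_loss.iterates_error[OF setting w \<delta> u eps grad sol, folded A_def]
  show "norm2 d (vsub (B l) bstar) \<le> 2 / rlo * (norm2 d (proj S (G bstar)) + epst * sqrt (real s)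
                 + lam * L2_set (\<lambda>j. w (\<bar>bstar j\<bar> - u)) S) + \<delta> * norm2 d (vsub (B (l - 1)) bstar)"
    using errors(1)[of n] unfolding l A_def by simp
  have "norm2 d (vsub (B l) bstar)
      \<le> 2 / (rlo * (1 - \<delta>)) * A + \<delta> ^ (l - 1) * (3 / rlo * (lam * sqrt s))"
    using errors(2)[of "Suc n"] unfolding l by simp
  also have "\<delta> ^ (l - 1) * (3 / rlo * (lam * sqrt s))
      \<le> \<delta> ^ (l - 1) * (2 * (2 / (rlo * (1 - \<delta>))) * (lam * sqrt s))"
  proof (intro mult_left_mono mult_right_mono)
    show "3 / rlo \<le> 2 * (2 / (rlo * (1 - \<delta>)))" using rlo \<delta> by (simp add: field_simps)
  qed (use lam \<delta> in auto)
  finally show "norm2 d (vsub (B l) bstar) \<le> 2 / (rlo * (1 - \<delta>)) *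
      (norm2 d (proj S (G bstar)) + epst * sqrt (real s)
                 + lam * L2_set (\<lambda>j. w (\<bar>bstar j\<bar> - u)) S)
      + 2 * (2 / (rlo * (1 - \<delta>))) * \<delta> ^ (l - 1) * lam * sqrt (real s)"
    by (simp add: A_def mult_ac)
qed auto

end
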